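(* Let $d\ge 2$ be an integer. A triple $(s_{\mathrm D},s_{\mathrm X},s_{\mathrm I})$ of nonnegative real numbers is of the form $(S_{\mathrm D}(\rho),S_{\mathrm X}(\rho),S_{\mathrm I}(\rho))$ for some quantum state $\rho$ of dimension $d$ if and only if all of the following hold: (i) $s_{\mathrm D}^2+s_{\mathrm X}^2+s_{\mathrm I}^2\le d-1$; (ii) $s_{\mathrm I}^2\le 1+s_{\mathrm D}^2+s_{\mathrm X}^2$; (iii) if $d$ is odd and $s_{\mathrm D}^2+s_{\mathrm X}^2\le \frac1{d-1}$, then $\sqrt d\,s_{\mathrm I}\le \sqrt{d-1}+\sqrt{s_{\mathrm D}^2+s_{\mathrm X}^2}$.
   Context: A quantum state of dimension $d$ is a complex Hermitian positive semidefinite $d\times d$ matrix $\rho$ with $\operatorname{Tr}\rho=1$. Write $\rho=\frac1d(\mathbb 1_d+D+X+I)$, where $\mathbb 1_d$ is the identity matrix, $D$ is a real traceless diagonal matrix, $X$ is a real symmetric matrix with zero diagonal, and $I=\frac d2(\rho-\rho^T)$ is the purely imaginary, skew-symmetric (Hermitian) part (here $^T$ denotes the transpose and $I$ is not the identity matrix); this decomposition is unique. Define the nonnegative numbers $$S_{\mathrm D}(\rho)=\sqrt{\operatorname{Tr}(D^2)/d},\quad S_{\mathrm X}(\rho)=\sqrt{\operatorname{Tr}(X^2)/d},\quad S_{\mathrm I}(\rho)=\sqrt{\operatorname{Tr}(I^2)/d}.$$ *)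

theory Defs
  imports Complex_Main "Jordan_Normal_Form.Schur_Decomposition"
begin

definition mat_trace :: "'a::comm_monoid_add mat \<Rightarrow> 'a" where
  "mat_trace A = (\<Sum>i<dim_row A. A $$ (i, i))"

(* The order on complex is the partial one: 0 \<le> z means that z is real and nonnegative. *)
definition psd_mat :: "nat \<Rightarrow> complex mat \<Rightarrow> bool" where
  "psd_mat d A \<longleftrightarrow> A \<in> carrier_mat d d \<and> mat_adjoint A = A \<and>
     (\<forall>v \<in> carrier_vec d. 0 \<le> (A *\<^sub>v v) \<bullet>c v)"

definition quantum_state :: "nat \<Rightarrow> complex mat \<Rightarrow> bool" where
  "quantum_state d \<rho> \<longleftrightarrow> psd_mat d \<rho> \<and> mat_trace \<rho> = 1"

text \<open>The decomposition of a state as (1/d) (1 + D + X + I), as a relation. The lemma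
  \<open>state_decomp_iff\<close> below shows that a state has exactly one, given by the functions
  \<open>D_part\<close>, \<open>X_part\<close>, \<open>I_part\<close>.\<close>

definition state_decomp ::
    "nat \<Rightarrow> complex mat \<Rightarrow> complex mat \<Rightarrow> complex mat \<Rightarrow> complex mat \<Rightarrow> bool" where
  "state_decomp d \<rho> D X I \<longleftrightarrow>
     D \<in> carrier_mat d d \<and> X \<in> carrier_mat d d \<and> I \<in> carrier_mat d d \<and>
     \<rho> = (1 / of_nat d) \<cdot>\<^sub>m (1\<^sub>m d + D + X + I) \<and>
     (\<forall>i<d. \<forall>j<d. D $$ (i, j) \<in> \<real>) \<and> diagonal_mat D \<and> mat_trace D = 0 \<and>
     (\<forall>i<d. \<forall>j<d. X $$ (i, j) \<in> \<real>) \<and> transpose_mat X = X \<and> (\<forall>i<d. X $$ (i, i) = 0) \<and>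
     (\<forall>i<d. \<forall>j<d. Re (I $$ (i, j)) = 0) \<and> transpose_mat I = - I"

definition D_part :: "complex mat \<Rightarrow> complex mat" where
  "D_part \<rho> = (let d = dim_row \<rho> in
     mat d d (\<lambda>(i, j). if i = j then of_nat d * \<rho> $$ (i, i) - 1 else 0))"

definition X_part :: "complex mat \<Rightarrow> complex mat" where
  "X_part \<rho> = (let d = dim_row \<rho> in
     mat d d (\<lambda>(i, j). if i = j then 0 else of_nat d / 2 * (\<rho> $$ (i, j) + \<rho> $$ (j, i))))"

definition I_part :: "complex mat \<Rightarrow> complex mat" where
  "I_part \<rho> = (of_nat (dim_row \<rho>) / 2) \<cdot>\<^sub>m (\<rho> - transpose_mat \<rho>)"

text \<open>For a state the three traces below are real, so taking the real part only converts the type.\<close>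

definition S_D :: "complex mat \<Rightarrow> real" where
  "S_D \<rho> = sqrt (Re (mat_trace (D_part \<rho> * D_part \<rho>)) / real (dim_row \<rho>))"

definition S_X :: "complex mat \<Rightarrow> real" where
  "S_X \<rho> = sqrt (Re (mat_trace (X_part \<rho> * X_part \<rho>)) / real (dim_row \<rho>))"

definition S_I :: "complex mat \<Rightarrow> real" where
  "S_I \<rho> = sqrt (Re (mat_trace (I_part \<rho> * I_part \<rho>)) / real (dim_row \<rho>))"

lemma mat_adjoint_index:
  assumes "A \<in> carrier_mat d d" "i < d" "j < d"
  shows "mat_adjoint A $$ (i, j) = conjugate (A $$ (j, i))"
  using assms by (simp add: mat_adjoint_def mat_of_rows_def)

lemma state_decomp_iff:
  assumes d: "d > 0" and st: "quantum_state d \<rho>"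
  shows "state_decomp d \<rho> D X I \<longleftrightarrow> D = D_part \<rho> \<and> X = X_part \<rho> \<and> I = I_part \<rho>"
proof -
  have car: "\<rho> \<in> carrier_mat d d" and adj: "mat_adjoint \<rho> = \<rho>" and tr: "mat_trace \<rho> = 1"
    using st by (auto simp: quantum_state_def psd_mat_def)
  have dim: "dim_row \<rho> = d" "dim_col \<rho> = d" using car by auto
  have herm: "\<rho> $$ (j, i) = cnj (\<rho> $$ (i, j))" if "i < d" "j < d" for i j
    using mat_adjoint_index[OF car that(2) that(1)] adj by simp
  show ?thesis
  proof
    assume dec: "state_decomp d \<rho> D X I"
    then have cars: "D \<in> carrier_mat d d" "X \<in> carrier_mat d d" "I \<in> carrier_mat d d"
      and eq: "\<rho> = (1 / of_nat d) \<cdot>\<^sub>m (1\<^sub>m d + D + X + I)"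
      and Dd: "diagonal_mat D" and XT: "transpose_mat X = X" and X0: "\<And>i. i < d \<Longrightarrow> X $$ (i, i) = 0"
      and IT: "transpose_mat I = - I"
      by (auto simp: state_decomp_def)
    have ent: "of_nat d * \<rho> $$ (i, j) = (if i = j then 1 else 0) + D $$ (i, j) + X $$ (i, j) + I $$ (i, j)"
      if "i < d" "j < d" for i j
      using that cars d by (subst eq) simp
    have Xs: "X $$ (j, i) = X $$ (i, j)" if "i < d" "j < d" for i j
      using arg_cong[OF XT, of "\<lambda>M. M $$ (i, j)"] that cars by simp
    have Is: "I $$ (j, i) = - I $$ (i, j)" if "i < d" "j < d" for i j
      using arg_cong[OF IT, of "\<lambda>M. M $$ (i, j)"] that cars by simp
    have I0: "I $$ (i, i) = 0" if "i < d" for i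
      using Is[OF that that] by simp
    have Doff: "D $$ (i, j) = 0" if "i < d" "j < d" "i \<noteq> j" for i j
      using Dd that cars by (auto simp: diagonal_mat_def)
    have "D = D_part \<rho>"
    proof (rule eq_matI)
      fix i j assume "i < dim_row (D_part \<rho>)" "j < dim_col (D_part \<rho>)"
      then have ij: "i < d" "j < d" by (auto simp: D_part_def Let_def dim)
      show "D $$ (i, j) = D_part \<rho> $$ (i, j)"
        using ij ent[OF ij] Doff[OF ij] X0 I0 by (auto simp: D_part_def Let_def dim)
    qed (use cars in \<open>auto simp: D_part_def Let_def dim\<close>)
    moreover have "X = X_part \<rho>"
    proof (rule eq_matI)
      fix i j assume "i < dim_row (X_part \<rho>)" "j < dim_col (X_part \<rho>)"
      then have ij: "i < d" "j < d" by (auto simp: X_part_def Let_def dim)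
      show "X $$ (i, j) = X_part \<rho> $$ (i, j)"
        using ij X0 ent[OF ij] ent[OF ij(2,1)] Doff[OF ij] Doff[OF ij(2,1)] Xs[OF ij] Is[OF ij]
        by (auto simp: X_part_def Let_def dim ring_distribs add_divide_distrib diff_divide_distrib)
    qed (use cars in \<open>auto simp: X_part_def Let_def dim\<close>)
    moreover have "I = I_part \<rho>"
    proof (rule eq_matI)
      fix i j assume "i < dim_row (I_part \<rho>)" "j < dim_col (I_part \<rho>)"
      then have ij: "i < d" "j < d" by (auto simp: I_part_def dim)
      show "I $$ (i, j) = I_part \<rho> $$ (i, j)"
        using ij ent[OF ij] ent[OF ij(2,1)] Doff[OF ij] Doff[OF ij(2,1)] Xs[OF ij] Is[OF ij] I0
        by (cases "i = j")
          (auto simp: I_part_def dim ring_distribs add_divide_distrib diff_divide_distrib)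
    qed (use cars in \<open>auto simp: I_part_def dim\<close>)
    ultimately show "D = D_part \<rho> \<and> X = X_part \<rho> \<and> I = I_part \<rho>" by simp
  next
    assume "D = D_part \<rho> \<and> X = X_part \<rho> \<and> I = I_part \<rho>"
    then have DXI: "D = D_part \<rho>" "X = X_part \<rho>" "I = I_part \<rho>" by auto
    have realdiag: "\<rho> $$ (i, i) \<in> \<real>" if "i < d" for i
      using herm[OF that that] by (simp add: Reals_cnj_iff)
    have realsum: "\<rho> $$ (i, j) + \<rho> $$ (j, i) \<in> \<real>" if "i < d" "j < d" for i j
      using herm[OF that] by (simp add: complex_is_Real_iff)
    have imdiff: "Re (\<rho> $$ (i, j)) = Re (\<rho> $$ (j, i))" if "i < d" "j < d" for i j
      using herm[OF that] by simp
    have sumtr: "(\<Sum>i<d. \<rho> $$ (i, i)) = 1" using tr by (simp add: mat_trace_def dim)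
    have "mat_trace D = (\<Sum>i<d. of_nat d * \<rho> $$ (i, i) - 1)"
      by (simp add: DXI mat_trace_def D_part_def Let_def dim)
    also have "\<dots> = of_nat d * (\<Sum>i<d. \<rho> $$ (i, i)) - of_nat d"
      by (simp add: sum_subtractf sum_distrib_left)
    finally have trD: "mat_trace D = 0" by (simp add: sumtr)
    have "\<rho> = (1 / of_nat d) \<cdot>\<^sub>m (1\<^sub>m d + D + X + I)"
      by (rule eq_matI)
        (use d in \<open>auto simp: DXI D_part_def X_part_def I_part_def Let_def dim field_simps\<close>)
    moreover have "diagonal_mat D"
      by (auto simp: diagonal_mat_def DXI D_part_def Let_def dim)
    moreover have "transpose_mat X = X" "transpose_mat I = - I"
      by (auto intro!: eq_matI simp: DXI X_part_def I_part_def Let_def dim algebra_simps)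
    moreover have "\<forall>i<d. \<forall>j<d. D $$ (i, j) \<in> \<real>" "\<forall>i<d. \<forall>j<d. X $$ (i, j) \<in> \<real>"
      using realdiag realsum by (auto simp: DXI D_part_def X_part_def Let_def dim)
    moreover have "\<forall>i<d. X $$ (i, i) = 0"
      by (auto simp: DXI X_part_def Let_def dim)
    moreover have "\<forall>i<d. \<forall>j<d. Re (I $$ (i, j)) = 0"
      using imdiff by (auto simp: DXI I_part_def dim)
    moreover have "D \<in> carrier_mat d d" "X \<in> carrier_mat d d" "I \<in> carrier_mat d d"
      using car by (auto simp: DXI D_part_def X_part_def I_part_def Let_def)
    ultimately show "state_decomp d \<rho> D X I" using trD by (simp add: state_decomp_def)
  qed
qed

end

theory Submission
  imports Defs "HOL-Analysis.Convex"
begin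

text \<open>Write a state as \<open>\<rho> = R + \<i>K\<close> with \<open>R\<close> real symmetric and \<open>K\<close> real skew-symmetric.
  Then \<open>Tr R\<^sup>2 = (1 + s\<^sub>D\<^sup>2 + s\<^sub>X\<^sup>2) / d\<close> and \<open>\<parallel>K\<parallel>\<^sup>2 = s\<^sub>I\<^sup>2 / d\<close>. Conditions (i) and (ii) say that \<open>Tr \<rho>\<^sup>2 \<le> 1\<close> and
  \<open>Tr (\<rho> \<rho>\<^sup>T) \<ge> 0\<close>. If \<open>d\<close> is odd, \<open>K\<close> kills a real unit vector \<open>v\<close>; compressing \<open>\<rho>\<close> to the
  complement of \<open>v\<close> sharpens (ii) to \<open>\<parallel>K\<parallel>\<^sup>2 \<le> \<parallel>R\<parallel>\<^sup>2 - (v\<^sup>T R v)\<^sup>2\<close>, while \<open>Tr R = 1\<close> and the size of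
  \<open>R\<close> bound \<open>v\<^sup>T R v\<close> from below; this gives (iii).

  Conversely, the conditions depend only on \<open>s\<^sub>D\<^sup>2 + s\<^sub>X\<^sup>2\<close>, so one first takes \<open>R\<close> diagonal. Given its spectrum,
  \<open>K\<close> can be put in \<open>2 \<times> 2\<close> blocks, each of which makes the corresponding block of \<open>\<rho>\<close> of rank one, and then
  be scaled down. The extremal spectra are those of two nonzero eigenvalues, of equal pairs, and, for odd \<open>d\<close>, of one
  small eigenvalue besides equal ones. Finally, real rotations move weight continuously from the diagonal of \<open>R\<close> to its
  off-diagonal part, until \<open>s\<^sub>D\<close> has the prescribed value.\<close>

section \<open>Positive semidefinite kernels\<close>

lemma sum_rotate3:
  "(\<Sum>i\<in>A. \<Sum>j\<in>B. \<Sum>k\<in>C. F i j k) = (\<Sum>k\<in>C. \<Sum>i\<in>A. \<Sum>j\<in>B. F i j k)"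
proof -
  have "(\<Sum>i\<in>A. \<Sum>j\<in>B. \<Sum>k\<in>C. F i j k) = (\<Sum>i\<in>A. \<Sum>k\<in>C. \<Sum>j\<in>B. F i j k)"
    by (intro sum.cong refl sum.swap)
  also have "\<dots> = (\<Sum>k\<in>C. \<Sum>i\<in>A. \<Sum>j\<in>B. F i j k)" by (rule sum.swap)
  finally show ?thesis .
qed

text \<open>Matrices are encoded as functions of their indices, constrained only below
  \<open>d\<close>, so that sums of entries can be handled directly. Nonnegativity of the form is
  stated through its real part; Hermitian symmetry makes the form real
  (\<open>hermitian_form_real\<close>).\<close>

definition psd_kernel :: "nat \<Rightarrow> (nat \<Rightarrow> nat \<Rightarrow> complex) \<Rightarrow> bool" where
  "psd_kernel d f \<longleftrightarrow> (\<forall>i<d. \<forall>j<d. f j i = cnj (f i j)) \<and>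
     (\<forall>x. 0 \<le> Re (\<Sum>i<d. \<Sum>j<d. cnj (x i) * f i j * x j))"

lemma psd_kernel_cnj: "psd_kernel d f \<Longrightarrow> i < d \<Longrightarrow> j < d \<Longrightarrow> f j i = cnj (f i j)"
  unfolding psd_kernel_def by blast

lemma psd_kernel_form: "psd_kernel d f \<Longrightarrow> 0 \<le> Re (\<Sum>i<d. \<Sum>j<d. cnj (x i) * f i j * x j)"
  unfolding psd_kernel_def by blast

lemma psd_kernel_Im_diag:
  assumes "psd_kernel d f" "i < d"
  shows "Im (f i i) = 0"
proof -
  have "Im (f i i) = Im (cnj (f i i))"
    by (rule arg_cong[OF psd_kernel_cnj[OF assms(1,2,2)]])
  then show ?thesis unfolding cnj.sel by linarith
qed

lemma hermitian_form_real:
  assumes "\<And>i j. i < d \<Longrightarrow> j < d \<Longrightarrow> f j i = cnj (f i j)"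
  shows "Im (\<Sum>i<d. \<Sum>j<d. cnj (x i) * f i j * x j) = 0"
proof -
  have "cnj (\<Sum>i<d. \<Sum>j<d. cnj (x i) * f i j * x j) = (\<Sum>i<d. \<Sum>j<d. x i * f j i * cnj (x j))"
    unfolding cnj_sum by (intro sum.cong refl) (simp flip: assms)
  also have "\<dots> = (\<Sum>i<d. \<Sum>j<d. cnj (x i) * f i j * x j)"
    by (subst sum.swap) (simp add: mult_ac)
  finally show ?thesis unfolding complex_is_Real_iff[symmetric] Reals_cnj_iff .
qed

text \<open>The form at \<open>x\<close> extended by a last coordinate \<open>z\<close>: a quadratic
  in \<open>z\<close>, ready for a Schur complement.\<close>

lemma psd_kernel_Suc_form:
  assumes "psd_kernel (Suc d) f"
  shows "0 \<le> Re (\<Sum>i<d. \<Sum>j<d. cnj (x i) * f i j * x j) + 2 * Re (z * (\<Sum>i<d. cnj (x i) * f i d))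
              + (cmod z)\<^sup>2 * Re (f d d)"
proof -
  define y where "y = x(d := z)"
  let ?L = "\<Sum>i<d. cnj (x i) * f i d"
  have y: "y d = z" "\<And>i. i < d \<Longrightarrow> y i = x i" by (auto simp: y_def)
  have row: "(\<Sum>j<d. cnj z * f d j * x j) = cnj (z * ?L)"
    unfolding sum_distrib_left cnj_sum
    by (intro sum.cong refl) (simp add: psd_kernel_cnj[OF assms, of _ d])
  have split: "(\<Sum>i<Suc d. \<Sum>j<Suc d. F i j) =
      (\<Sum>i<d. \<Sum>j<d. F i j) + (\<Sum>i<d. F i d) + (\<Sum>j<d. F d j) + F d d" for F :: "nat \<Rightarrow> nat \<Rightarrow> complex"
    by (simp add: sum.distrib)
  have "(\<Sum>i<d. \<Sum>j<d. cnj (y i) * f i j * y j) = (\<Sum>i<d. \<Sum>j<d. cnj (x i) * f i j * x j)"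
    by (simp add: y)
  moreover have "(\<Sum>i<d. cnj (y i) * f i d * y d) = z * ?L"
    unfolding sum_distrib_left by (intro sum.cong refl) (simp add: y mult_ac)
  moreover have "(\<Sum>j<d. cnj (y d) * f d j * y j) = cnj (z * ?L)"
    unfolding row[symmetric] by (intro sum.cong refl) (simp add: y)
  ultimately have eq: "(\<Sum>i<Suc d. \<Sum>j<Suc d. cnj (y i) * f i j * y j) =
    (\<Sum>i<d. \<Sum>j<d. cnj (x i) * f i j * x j) + z * ?L + cnj (z * ?L) + cnj z * f d d * z"
    unfolding split by (simp only: y(1))
  have "Re (cnj z * f d d * z) = (cmod z)\<^sup>2 * Re (f d d)"
    using psd_kernel_Im_diag[OF assms, of d]
    unfolding cmod_power2 by (simp add: power2_eq_square algebra_simps)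
  moreover have "Re (a + b + cnj b + c) = Re a + 2 * Re b + Re c" for a b c by simp
  ultimately show ?thesis using psd_kernel_form[OF assms, of y] unfolding eq by (simp only:)
qed

lemma affine_nonneg_imp_zero:
  fixes a :: real
  assumes "\<And>z. 0 \<le> a + 2 * Re (z * w)"
  shows "w = 0"
proof (rule ccontr)
  assume "w \<noteq> 0"
  define c where "c = - (a + 1) / 2"
  have "of_real c / w * w = of_real c" using \<open>w \<noteq> 0\<close> by simp
  then have "Re (of_real c / w * w) = c" by (simp only: Re_complex_of_real)
  then have "0 \<le> a + 2 * c"
    using assms[of "of_real c / w"] by linarith
  then show False by (simp add: c_def field_simps)
qed

text \<open>Cholesky decomposition by induction: the last column, suitably scaled, is one Gram
  vector, and the Schur complement of the last diagonal entry is again positive semidefinite and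
  supplies the others.\<close>

lemma psd_kernel_gram:
  assumes "psd_kernel d f"
  shows "\<exists>w. \<forall>i<d. \<forall>j<d. f i j = (\<Sum>k<d. w k i * cnj (w k j))"
  using assms
proof (induction d arbitrary: f)
  case 0
  then show ?case by simp
next
  case (Suc d)
  note cnjf = psd_kernel_cnj[OF Suc.prems] and form = psd_kernel_Suc_form[OF Suc.prems]
  define a where "a = Re (f d d)"
  have fdd: "f d d = of_real a"
    using psd_kernel_Im_diag[OF Suc.prems, of d] by (simp add: a_def complex_eq_iff)
  have "0 \<le> a" using form[of "\<lambda>_. 0" 1] by (simp add: a_def)
  \<comment> \<open>Schur complement; if \<open>a = 0\<close> the last column vanishes, so the division by zero is harmless\<close>
  define g where "g i j = f i j - f i d * cnj (f j d) / of_real a" for i j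
  have col0: "f i d = 0" if "a = 0" "i < d" for i
  proof -
    \<comment> \<open>Testing with a unit vector leaves an expression affine in \<open>z\<close>,
      since the quadratic term carries the factor \<open>a = 0\<close>; nonnegativity for all
      \<open>z\<close> kills its slope.\<close>
    let ?x = "\<lambda>j. if j = i then 1 else (0::complex)"
    have L: "(\<Sum>j<d. cnj (?x j) * f j d) = f i d"
      using that by (subst sum.remove[of _ i]) auto
    show ?thesis
      using form[of ?x] unfolding L
      by (intro affine_nonneg_imp_zero) (use that in \<open>simp add: a_def[symmetric]\<close>)
  qed
  have "psd_kernel d g"
    unfolding psd_kernel_def
  proof (intro conjI allI impI)
    show "g j i = cnj (g i j)" if "i < d" "j < d" for i j
      using that cnjf[of i j] by (simp add: g_def)
    fix x :: "nat \<Rightarrow> complex"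
    define L where "L = (\<Sum>i<d. cnj (x i) * f i d)"
    have "(\<Sum>i<d. \<Sum>j<d. cnj (x i) * g i j * x j) =
      (\<Sum>i<d. \<Sum>j<d. cnj (x i) * f i j * x j) - (\<Sum>i<d. \<Sum>j<d. (cnj (x i) * f i d) * cnj (cnj (x j) * f j d) / a)"
      by (simp add: g_def algebra_simps sum_subtractf)
    also have "(\<Sum>i<d. \<Sum>j<d. (cnj (x i) * f i d) * cnj (cnj (x j) * f j d) / a) = L * cnj L / a"
      unfolding L_def by (simp only: cnj_sum sum_product sum_divide_distrib)
    also have "\<dots> = of_real ((cmod L)\<^sup>2 / a)" by (simp only: complex_norm_square[symmetric] of_real_divide)
    finally have eq: "Re (\<Sum>i<d. \<Sum>j<d. cnj (x i) * g i j * x j) =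
      Re (\<Sum>i<d. \<Sum>j<d. cnj (x i) * f i j * x j) - (cmod L)\<^sup>2 / a" by simp
    \<comment> \<open>For \<open>a > 0\<close> the last coordinate
      \<open>- cnj L / of_real a\<close> minimises the quadratic in \<open>form\<close>, and the
      minimum is the form of \<open>g\<close> at \<open>x\<close>. For \<open>a = 0\<close> it is 0
      by convention and both identities read \<open>0 = 0\<close>.\<close>
    have "Re (- cnj L / of_real a * L) = - ((cmod L)\<^sup>2 / a)"
      unfolding cmod_power2 by (cases "a = 0") (simp_all add: power2_eq_square field_simps)
    moreover have "(cmod (- cnj L / of_real a))\<^sup>2 * a = (cmod L)\<^sup>2 / a"
      by (simp add: norm_divide power_divide power2_eq_square)
    ultimately show "0 \<le> Re (\<Sum>i<d. \<Sum>j<d. cnj (x i) * g i j * x j)"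
      unfolding eq using form[of x "- cnj L / of_real a", folded L_def a_def] by linarith
  qed
  then obtain w where w: "\<And>i j. i < d \<Longrightarrow> j < d \<Longrightarrow> g i j = (\<Sum>k<d. w k i * cnj (w k j))"
    using Suc.IH by blast
  define u where "u k i = (if k = d then f i d / of_real (sqrt a) else if i = d then 0 else w k i)" for k i
  have last: "u d i * cnj (u d j) = f i d * cnj (f j d) / of_real a" for i j
    using \<open>0 \<le> a\<close> by (simp add: u_def flip: of_real_mult)
  have "f i j = (\<Sum>k<Suc d. u k i * cnj (u k j))" if "i < Suc d" "j < Suc d" for i j
  proof -
    have "(\<Sum>k<d. u k i * cnj (u k j)) = (if i < d \<and> j < d then g i j else 0)"
      using that w by (auto simp: u_def intro!: sum.neutral)
    then have sum: "(\<Sum>k<Suc d. u k i * cnj (u k j)) = (if i < d \<and> j < d then g i j else 0) + f i d * cnj (f j d) / of_real a"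
      using last by simp
    consider "i < d" "j < d" | "i = d" | "j = d" "i < d" using \<open>i < Suc d\<close> \<open>j < Suc d\<close> by linarith
    then show ?thesis
    proof cases
      case 1 then show ?thesis unfolding sum by (simp add: g_def)
    next
      case 2
      have "f d j = cnj (f j d)" using that by (intro cnjf) auto
      moreover have "f j d = 0" if "a = 0"
        using that fdd col0[of j] \<open>j < Suc d\<close> by (cases "j = d") auto
      ultimately show ?thesis unfolding sum using 2 fdd by (cases "a = 0") auto
    next
      case 3 then show ?thesis
        unfolding sum using col0[of i] fdd by (cases "a = 0") auto
    qed
  qed
  then show ?case by blast
qed

text \<open>Cauchy-Schwarz over the Gram index gives \<open>|f i j|^2 <= f i i * f j j\<close>, and
  the double sum of the right-hand sides factors.\<close>

lemma psd_kernel_sum_norm_le: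
  assumes "psd_kernel d f"
  shows "(\<Sum>i<d. \<Sum>j<d. (cmod (f i j))\<^sup>2) \<le> (\<Sum>i<d. Re (f i i))\<^sup>2"
proof -
  obtain w where w: "\<And>i j. i < d \<Longrightarrow> j < d \<Longrightarrow> f i j = (\<Sum>k<d. w k i * cnj (w k j))"
    using psd_kernel_gram[OF assms] by blast
  have diag: "Re (f i i) = (\<Sum>k<d. (cmod (w k i))\<^sup>2)" if "i < d" for i
    using that by (simp only: w complex_norm_square[symmetric] Re_sum Re_complex_of_real)
  have "(cmod (f i j))\<^sup>2 \<le> Re (f i i) * Re (f j j)" if "i < d" "j < d" for i j
  proof -
    have "cmod (f i j) \<le> (\<Sum>k<d. cmod (w k i) * cmod (w k j))"
      using that by (simp add: w) (rule order.trans[OF norm_sum], simp add: norm_mult)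
    then have "(cmod (f i j))\<^sup>2 \<le> (\<Sum>k<d. cmod (w k i) * cmod (w k j))\<^sup>2"
      by (intro power_mono) auto
    also have "\<dots> \<le> (\<Sum>k<d. (cmod (w k i))\<^sup>2) * (\<Sum>k<d. (cmod (w k j))\<^sup>2)"
      by (rule Cauchy_Schwarz_ineq_sum)
    finally show ?thesis using that by (simp add: diag)
  qed
  then show ?thesis
    unfolding power2_eq_square[of "sum _ _"] sum_product by (intro sum_mono) auto
qed

text \<open>With a Gram decomposition into vectors \<open>w\<^sub>k\<close>, the expression is the sum of
  \<open>\<bar>w\<^sub>k\<^sup>T w\<^sub>l - (v\<^sup>T w\<^sub>k) (v\<^sup>T w\<^sub>l)\<bar>\<^sup>2\<close> over all pairs.\<close>
lemma psd_kernel_transpose_ineq: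
  fixes v :: "nat \<Rightarrow> real" and f :: "nat \<Rightarrow> nat \<Rightarrow> complex"
  assumes "psd_kernel d f"
  shows "0 \<le> Re ((\<Sum>i<d. \<Sum>j<d. (f i j)\<^sup>2) - 2 * (\<Sum>i<d. (\<Sum>j<d. f i j * v j)\<^sup>2)
    + (\<Sum>i<d. \<Sum>j<d. v i * f i j * v j)\<^sup>2)"
proof -
  obtain w where w: "\<And>i j. i < d \<Longrightarrow> j < d \<Longrightarrow> f i j = (\<Sum>k<d. w k i * cnj (w k j))"
    using psd_kernel_gram[OF assms] by blast
  define \<alpha> where "\<alpha> k = (\<Sum>i<d. v i * w k i)" for k
  define h where "h k l = (\<Sum>i<d. w k i * w l i)" for k l
  have 1: "(\<Sum>i<d. \<Sum>j<d. (f i j)\<^sup>2) = (\<Sum>k<d. \<Sum>l<d. h k l * cnj (h k l))"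
  proof -
    have "(\<Sum>i<d. \<Sum>j<d. (f i j)\<^sup>2) = (\<Sum>i<d. \<Sum>j<d. \<Sum>k<d. \<Sum>l<d. (w k i * w l i) * cnj (w k j * w l j))"
      by (intro sum.cong refl) (simp add: w power2_eq_square sum_product mult_ac)
    also have "\<dots> = (\<Sum>k<d. \<Sum>l<d. \<Sum>i<d. \<Sum>j<d. (w k i * w l i) * cnj (w k j * w l j))"
      by (subst sum_rotate3) (intro sum.cong refl sum_rotate3)
    finally show ?thesis by (simp only: h_def cnj_sum sum_product)
  qed
  have fv: "(\<Sum>j<d. f i j * v j) = (\<Sum>k<d. w k i * cnj (\<alpha> k))" if "i < d" for i
  proof -
    have "(\<Sum>j<d. f i j * v j) = (\<Sum>j<d. \<Sum>k<d. w k i * cnj (w k j) * v j)"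
      using that by (simp add: w sum_distrib_right)
    then show ?thesis
      by (subst (asm) sum.swap) (simp add: \<alpha>_def sum_distrib_left mult_ac)
  qed
  have 2: "(\<Sum>i<d. (\<Sum>j<d. f i j * v j)\<^sup>2) = (\<Sum>k<d. \<Sum>l<d. h k l * cnj (\<alpha> k * \<alpha> l))"
  proof -
    have "(\<Sum>i<d. (\<Sum>j<d. f i j * v j)\<^sup>2) = (\<Sum>i<d. \<Sum>k<d. \<Sum>l<d. w k i * w l i * cnj (\<alpha> k * \<alpha> l))"
      by (intro sum.cong refl, simp only: fv lessThan_iff) (simp add: power2_eq_square sum_product mult_ac)
    also have "\<dots> = (\<Sum>k<d. \<Sum>l<d. \<Sum>i<d. w k i * w l i * cnj (\<alpha> k * \<alpha> l))"
      by (subst sum_rotate3, subst sum_rotate3) (rule refl)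
    finally show ?thesis by (simp only: h_def sum_distrib_right)
  qed
  have 3: "(\<Sum>i<d. \<Sum>j<d. v i * f i j * v j)\<^sup>2 = (\<Sum>k<d. \<Sum>l<d. \<alpha> k * \<alpha> l * cnj (\<alpha> k * \<alpha> l))"
  proof -
    have "(\<Sum>i<d. \<Sum>j<d. v i * f i j * v j) = (\<Sum>i<d. v i * (\<Sum>k<d. w k i * cnj (\<alpha> k)))"
      by (intro sum.cong refl, simp only: lessThan_iff fv[symmetric]) (simp add: sum_distrib_left mult_ac)
    also have "\<dots> = (\<Sum>k<d. \<alpha> k * cnj (\<alpha> k))"
      unfolding sum_distrib_left by (subst sum.swap) (simp add: \<alpha>_def sum_distrib_right mult_ac)
    finally show ?thesis by (simp add: power2_eq_square sum_product mult_ac)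
  qed
  have "0 \<le> (\<Sum>k<d. \<Sum>l<d. (cmod (h k l - \<alpha> k * \<alpha> l))\<^sup>2)"
    by (intro sum_nonneg) auto
  also have "\<dots> = Re (\<Sum>k<d. \<Sum>l<d. h k l * cnj (h k l) - 2 * (h k l * cnj (\<alpha> k * \<alpha> l)) + \<alpha> k * \<alpha> l * cnj (\<alpha> k * \<alpha> l))"
    unfolding Re_sum
  proof (intro sum.cong refl)
    fix k l
    have "(cmod (x - y))\<^sup>2 = Re (x * cnj x - 2 * (x * cnj y) + y * cnj y)" for x y
      unfolding cmod_power2 by (simp add: power2_eq_square algebra_simps)
    then show "(cmod (h k l - \<alpha> k * \<alpha> l))\<^sup>2 = 
      Re (h k l * cnj (h k l) - 2 * (h k l * cnj (\<alpha> k * \<alpha> l)) + \<alpha> k * \<alpha> l * cnj (\<alpha> k * \<alpha> l))" .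
  qed
  finally show ?thesis
    unfolding 1 2 3 by (simp only: sum.distrib sum_subtractf sum_distrib_left)
qed

section \<open>Necessity of the conditions\<close>

text \<open>For \<open>v = 0\<close> the transpose inequality says that the real part of Tr(f f^T)
  is nonnegative.\<close>

lemma psd_kernel_Im_le_Re:
  assumes "psd_kernel d f"
  shows "(\<Sum>i<d. \<Sum>j<d. (Im (f i j))\<^sup>2) \<le> (\<Sum>i<d. \<Sum>j<d. (Re (f i j))\<^sup>2)"
  using psd_kernel_transpose_ineq[OF assms, of "\<lambda>_. 0"] by (simp add: sum_subtractf power2_eq_square)

text \<open>A skew matrix of odd size has \<open>det A = (-1)^d * det A = - det A\<close>, hence is
  singular; a nonzero vector it kills is then normalised.\<close>

lemma skew_odd_kernel_vector:
  fixes K :: "nat \<Rightarrow> nat \<Rightarrow> real"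
  assumes skew: "\<And>i j. i < d \<Longrightarrow> j < d \<Longrightarrow> K j i = - K i j" and "odd d"
  shows "\<exists>v. (\<Sum>i<d. (v i)\<^sup>2) = 1 \<and> (\<forall>i<d. (\<Sum>j<d. K i j * v j) = 0)"
proof -
  define A where "A = mat d d (\<lambda>(i, j). K i j)"
  have A: "A \<in> carrier_mat d d" by (simp add: A_def)
  have "transpose_mat A = (-1) \<cdot>\<^sub>m A" by (rule eq_matI) (auto simp: A_def intro: skew)
  then have "det A = - det A"
    using det_transpose[OF A] A \<open>odd d\<close> by simp
  then have "det A = 0" by simp
  then obtain x where x: "x \<in> carrier_vec d" "x \<noteq> 0\<^sub>v d" "A *\<^sub>v x = 0\<^sub>v d"
    using det_0_iff_vec_prod_zero_field[OF A] by blast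
  define s where "s = (\<Sum>i<d. (x $ i)\<^sup>2)"
  have "s \<noteq> 0"
  proof
    assume "s = 0"
    then have "x $ i = 0" if "i < d" for i
      using that by (simp add: s_def sum_nonneg_eq_0_iff)
    then show False using x by (metis carrier_vecD eq_vecI index_zero_vec)
  qed
  then have "s > 0" by (simp add: s_def sum_nonneg order.not_eq_order_implies_strict)
  have Ax: "(\<Sum>j<d. K i j * x $ j) = 0" if "i < d" for i
    using arg_cong[OF x(3), of "\<lambda>y. y $ i"] that x(1)
    by (simp add: A_def scalar_prod_def atLeast0LessThan)
  show ?thesis
  proof (intro exI[of _ "\<lambda>i. x $ i / sqrt s"] conjI allI impI)
    show "(\<Sum>i<d. (x $ i / sqrt s)\<^sup>2) = 1"
      using \<open>s > 0\<close> by (simp add: power_divide sum_divide_distrib[symmetric] s_def[symmetric])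
    show "(\<Sum>j<d. K i j * (x $ j / sqrt s)) = 0" if "i < d" for i
      using Ax[OF that] by (simp add: sum_divide_distrib[symmetric])
  qed
qed

text \<open>Among matrices with trace 1 and value \<open>q\<close> at \<open>v\<close>, the smallest
  Frobenius norm belongs to \<open>c 1 + b v v^T\<close>, which has eigenvalue \<open>q\<close> on
  \<open>v\<close> and \<open>c\<close> on its complement. Expanding the squared distance of
  \<open>R\<close> from this matrix gives the bound.\<close>

lemma frobenius_ge_unit_vector:
  fixes R :: "nat \<Rightarrow> nat \<Rightarrow> real"
  assumes "d \<ge> 2" and tr: "(\<Sum>i<d. R i i) = 1" and v: "(\<Sum>i<d. (v i)\<^sup>2) = 1"
    and q: "q = (\<Sum>i<d. \<Sum>j<d. v i * R i j * v j)"
  shows "q\<^sup>2 + (1 - q)\<^sup>2 / (real d - 1) \<le> (\<Sum>i<d. \<Sum>j<d. (R i j)\<^sup>2)"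
proof -
  define c where "c = (1 - q) / (real d - 1)"
  define b where "b = q - c"
  have delta: "(\<Sum>i<d. \<Sum>j<d. if i = j then g i j else 0) = (\<Sum>i<d. g i i)" for g :: "nat \<Rightarrow> nat \<Rightarrow> real"
    by (intro sum.cong refl) simp
  have "0 \<le> (\<Sum>i<d. \<Sum>j<d. (R i j - (if i = j then c else 0) - b * (v i * v j))\<^sup>2)"
    by (intro sum_nonneg) auto
  also have "\<dots> = (\<Sum>i<d. \<Sum>j<d. (R i j)\<^sup>2 + b\<^sup>2 * ((v i)\<^sup>2 * (v j)\<^sup>2) - 2 * b * (v i * R i j * v j)
      + (if i = j then c\<^sup>2 - 2 * c * R i j + 2 * c * b * (v i * v j) else 0))"
    by (intro sum.cong refl) (simp add: power2_eq_square algebra_simps)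
  also have "\<dots> = (\<Sum>i<d. \<Sum>j<d. (R i j)\<^sup>2) + b\<^sup>2 * ((\<Sum>i<d. (v i)\<^sup>2) * (\<Sum>i<d. (v i)\<^sup>2)) - 2 * b * q
      + (\<Sum>i<d. c\<^sup>2 - 2 * c * R i i + 2 * c * b * (v i * v i))"
    unfolding q sum_product by (simp only: sum.distrib sum_subtractf delta sum_distrib_left)
  also have "(\<Sum>i<d. c\<^sup>2 - 2 * c * R i i + 2 * c * b * (v i * v i)) = real d * c\<^sup>2 - 2 * c + 2 * c * b"
    using tr v by (simp add: sum.distrib sum_subtractf sum_distrib_left[symmetric] power2_eq_square)
  finally have "0 \<le> (\<Sum>i<d. \<Sum>j<d. (R i j)\<^sup>2) + b\<^sup>2 - 2 * b * q + (real d * c\<^sup>2 - 2 * c + 2 * c * b)"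
    by (simp add: v)
  moreover have "b\<^sup>2 - 2 * b * q + (real d * c\<^sup>2 - 2 * c + 2 * c * b) = (real d - 1) * c\<^sup>2 - 2 * c * (1 - q) - q\<^sup>2"
    by (simp add: b_def power2_eq_square algebra_simps)
  moreover have "(real d - 1) * c\<^sup>2 - 2 * c * (1 - q) = - ((1 - q)\<^sup>2 / (real d - 1))"
  proof -
    have ce: "(real d - 1) * c = 1 - q" using \<open>d \<ge> 2\<close> by (simp add: c_def)
    have "(real d - 1) * c\<^sup>2 = (1 - q) * c" by (simp add: power2_eq_square flip: ce)
    moreover have "(1 - q)\<^sup>2 / (real d - 1) = (1 - q) * c" by (simp add: c_def power2_eq_square)
    ultimately show ?thesis by (simp add: algebra_simps)
  qed
  ultimately show ?thesis by linarith
qed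

text \<open>Since the imaginary part kills \<open>v\<close>, the vector \<open>f v\<close> is the
  real vector \<open>u\<close>. Then \<open>psd_kernel_transpose_ineq\<close> bounds the difference
  of the squared norms below by \<open>2 |u|^2 - q^2\<close>, and Cauchy-Schwarz gives
  \<open>q^2 <= |u|^2\<close>.\<close>

lemma psd_kernel_Im_le_of_unit_vector:
  fixes v :: "nat \<Rightarrow> real"
  assumes psd: "psd_kernel d f" and v: "(\<Sum>i<d. (v i)\<^sup>2) = 1"
    and Kv: "\<And>i. i < d \<Longrightarrow> (\<Sum>j<d. Im (f i j) * v j) = 0"
  shows "(\<Sum>i<d. \<Sum>j<d. (Im (f i j))\<^sup>2) \<le>
    (\<Sum>i<d. \<Sum>j<d. (Re (f i j))\<^sup>2) - (\<Sum>i<d. \<Sum>j<d. v i * Re (f i j) * v j)\<^sup>2"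
proof -
  define u where "u i = (\<Sum>j<d. Re (f i j) * v j)" for i
  define q where "q = (\<Sum>i<d. \<Sum>j<d. v i * Re (f i j) * v j)"
  have q: "q = (\<Sum>i<d. v i * u i)"
    by (simp add: q_def u_def sum_distrib_left mult_ac)
  have fv: "(\<Sum>j<d. f i j * v j) = of_real (u i)" if "i < d" for i
    using Kv[OF that] by (simp add: complex_eq_iff u_def)
  have vfv: "(\<Sum>i<d. \<Sum>j<d. v i * f i j * v j) = of_real q"
  proof -
    have "(\<Sum>i<d. \<Sum>j<d. v i * f i j * v j) = (\<Sum>i<d. v i * (\<Sum>j<d. f i j * v j))"
      by (simp add: sum_distrib_left mult_ac)
    also have "\<dots> = (\<Sum>i<d. of_real (v i) * of_real (u i))"
      by (intro sum.cong refl, simp only: lessThan_iff fv)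
    finally show ?thesis by (simp add: q)
  qed
  have "(\<Sum>i<d. (\<Sum>j<d. f i j * v j)\<^sup>2) = of_real (\<Sum>i<d. (u i)\<^sup>2)"
    unfolding of_real_sum of_real_power by (intro sum.cong refl, simp only: lessThan_iff fv)
  then have "0 \<le> Re ((\<Sum>i<d. \<Sum>j<d. (f i j)\<^sup>2) - 2 * of_real (\<Sum>i<d. (u i)\<^sup>2) + (of_real q)\<^sup>2)"
    using psd_kernel_transpose_ineq[OF psd, of v] unfolding vfv by (simp only:)
  also have "\<dots> = (\<Sum>i<d. \<Sum>j<d. (Re (f i j))\<^sup>2) - (\<Sum>i<d. \<Sum>j<d. (Im (f i j))\<^sup>2) - 2 * (\<Sum>i<d. (u i)\<^sup>2) + q\<^sup>2"
    by (simp add: sum_subtractf power2_eq_square)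
  finally have "0 \<le> (\<Sum>i<d. \<Sum>j<d. (Re (f i j))\<^sup>2) - (\<Sum>i<d. \<Sum>j<d. (Im (f i j))\<^sup>2) - 2 * (\<Sum>i<d. (u i)\<^sup>2) + q\<^sup>2" .
  moreover have "q\<^sup>2 \<le> (\<Sum>i<d. (u i)\<^sup>2)"
    using Cauchy_Schwarz_ineq_sum[of v u "{..<d}"] v by (simp add: q)
  ultimately show ?thesis unfolding q_def[symmetric] by linarith
qed

text \<open>With \<open>r = sqrt (d - 1)\<close>, a small norm of the real part forces
  \<open>d q >= 1 - t r\<close>, while a large \<open>q\<close> lowers the norm of the imaginary
  part. The two bounds combine to the perfect square \<open>(r + t)^2\<close>.\<close>

lemma psd_kernel_Im_odd:
  fixes t :: real
  assumes psd: "psd_kernel d f" and tr: "(\<Sum>i<d. Re (f i i)) = 1" and "odd d" "d \<ge> 2"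
    and "t \<ge> 0" and t: "t\<^sup>2 \<le> 1 / (real d - 1)"
    and Q: "(\<Sum>i<d. \<Sum>j<d. (Re (f i j))\<^sup>2) = (1 + t\<^sup>2) / real d"
  shows "real d * sqrt (\<Sum>i<d. \<Sum>j<d. (Im (f i j))\<^sup>2) \<le> sqrt (real d - 1) + t"
proof -
  define r where "r = sqrt (real d - 1)"
  have r: "r > 0" "r\<^sup>2 = real d - 1" using \<open>d \<ge> 2\<close> by (auto simp: r_def)
  have skew: "Im (f j i) = - Im (f i j)" if "i < d" "j < d" for i j
    by (subst psd_kernel_cnj[OF psd that]) simp
  obtain v where v: "(\<Sum>i<d. (v i)\<^sup>2) = 1" "\<And>i. i < d \<Longrightarrow> (\<Sum>j<d. Im (f i j) * v j) = 0"
    using skew_odd_kernel_vector[of d "\<lambda>i j. Im (f i j)", OF skew \<open>odd d\<close>] by blast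
  define q where "q = (\<Sum>i<d. \<Sum>j<d. v i * Re (f i j) * v j)"
  have K: "(\<Sum>i<d. \<Sum>j<d. (Im (f i j))\<^sup>2) \<le> (1 + t\<^sup>2) / real d - q\<^sup>2"
    using psd_kernel_Im_le_of_unit_vector[OF psd v] by (simp only: q_def Q)
  have "q\<^sup>2 + (1 - q)\<^sup>2 / r\<^sup>2 \<le> (1 + t\<^sup>2) / (r\<^sup>2 + 1)"
    using frobenius_ge_unit_vector[of d "\<lambda>i j. Re (f i j)", OF \<open>d \<ge> 2\<close> tr v(1) q_def] by (simp add: Q r)
  then have "(q\<^sup>2 + (1 - q)\<^sup>2 / r\<^sup>2) * (r\<^sup>2 * (r\<^sup>2 + 1)) \<le> (1 + t\<^sup>2) / (r\<^sup>2 + 1) * (r\<^sup>2 * (r\<^sup>2 + 1))"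
    by (intro mult_right_mono) auto
  moreover have "(1 + t\<^sup>2) / (r\<^sup>2 + 1) * (r\<^sup>2 * (r\<^sup>2 + 1)) = (1 + t\<^sup>2) * r\<^sup>2"
  proof -
    have "r\<^sup>2 + 1 > 0" by (simp add: add_nonneg_pos)
    then show ?thesis by simp
  qed
  moreover have "(q\<^sup>2 + (1 - q)\<^sup>2 / r\<^sup>2) * (r\<^sup>2 * (r\<^sup>2 + 1)) = (q\<^sup>2 * r\<^sup>2 + (1 - q)\<^sup>2) * (r\<^sup>2 + 1)"
    using \<open>r > 0\<close> by (simp add: field_simps)
  \<comment> \<open>Completing the square in \<open>q\<close>, where
    \<open>r^2 + 1 = d\<close>.\<close>
  moreover have "(q\<^sup>2 * r\<^sup>2 + (1 - q)\<^sup>2) * (r\<^sup>2 + 1) = ((r\<^sup>2 + 1) * q - 1)\<^sup>2 + r\<^sup>2"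
    by (simp add: power2_eq_square algebra_simps)
  ultimately have "((r\<^sup>2 + 1) * q - 1)\<^sup>2 \<le> (t * r)\<^sup>2"
    by (simp add: power_mult_distrib algebra_simps)
  then have "\<bar>(r\<^sup>2 + 1) * q - 1\<bar> \<le> t * r"
    using \<open>t \<ge> 0\<close> \<open>r > 0\<close> by (simp add: abs_le_square_iff[symmetric])
  then have qa: "1 - t * r \<le> real d * q" by (simp add: r)
  \<comment> \<open>The bound on \<open>t\<close> makes \<open>1 - t r\<close> nonnegative, so the
    lower bound on \<open>d q\<close> can be squared.\<close>
  have "(t * r)\<^sup>2 = t\<^sup>2 * (real d - 1)" unfolding power_mult_distrib r ..
  also have "\<dots> \<le> 1" using t \<open>d \<ge> 2\<close> by (simp add: field_simps)
  finally have "(t * r)\<^sup>2 \<le> 1" .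
  then have "0 \<le> 1 - t * r" using power2_le_imp_le[of "t * r" 1] by simp
  then have "(1 - t * r)\<^sup>2 \<le> (real d * q)\<^sup>2" using qa by (intro power_mono)
  moreover have "(real d)\<^sup>2 * (\<Sum>i<d. \<Sum>j<d. (Im (f i j))\<^sup>2) \<le> (real d)\<^sup>2 * ((1 + t\<^sup>2) / real d - q\<^sup>2)"
    using K by (intro mult_left_mono) auto
  moreover have "(real d)\<^sup>2 * ((1 + t\<^sup>2) / real d - q\<^sup>2) = (r\<^sup>2 + 1) * (1 + t\<^sup>2) - (real d * q)\<^sup>2"
  proof -
    have "r\<^sup>2 + 1 = real d" by (simp add: r)
    then show ?thesis using \<open>d \<ge> 2\<close> by (simp add: power2_eq_square field_simps)
  qed
  moreover have "(r\<^sup>2 + 1) * (1 + t\<^sup>2) - (1 - t * r)\<^sup>2 = (r + t)\<^sup>2"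
    by (simp add: power2_eq_square algebra_simps)
  ultimately have "(real d)\<^sup>2 * (\<Sum>i<d. \<Sum>j<d. (Im (f i j))\<^sup>2) \<le> (r + t)\<^sup>2" by linarith
  then have "sqrt ((real d)\<^sup>2 * (\<Sum>i<d. \<Sum>j<d. (Im (f i j))\<^sup>2)) \<le> r + t"
    using \<open>t \<ge> 0\<close> \<open>r > 0\<close> by (intro real_le_lsqrt) (auto simp: sum_nonneg)
  then show ?thesis by (simp add: real_sqrt_mult r_def)
qed

section \<open>Plane rotations and the diagonal\<close>

text \<open>Over \<open>real_vector\<close>, so that one definition rotates both real and complex
  tuples by a real angle.\<close>

definition rot :: "nat \<Rightarrow> nat \<Rightarrow> real \<Rightarrow> (nat \<Rightarrow> 'a::real_vector) \<Rightarrow> nat \<Rightarrow> 'a" where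
  "rot p q \<theta> x i = (if i = p then cos \<theta> *\<^sub>R x p - sin \<theta> *\<^sub>R x q
     else if i = q then sin \<theta> *\<^sub>R x p + cos \<theta> *\<^sub>R x q else x i)"

text \<open>The congruence U f U^T by the rotation U in the plane of \<open>p\<close> and
  \<open>q\<close>: the inner rotation acts on the column index, the outer one on the row
  index.\<close>

definition conj_rot :: "nat \<Rightarrow> nat \<Rightarrow> real \<Rightarrow> (nat \<Rightarrow> nat \<Rightarrow> 'a::real_vector) \<Rightarrow> nat \<Rightarrow> nat \<Rightarrow> 'a" where
  "conj_rot p q \<theta> f i j = rot p q \<theta> (\<lambda>k. rot p q \<theta> (f k) j) i"

lemma sum_split_pair:
  fixes g :: "nat \<Rightarrow> 'a::comm_monoid_add"
  assumes "p < d" "q < d" "p \<noteq> q"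
  shows "(\<Sum>i<d. g i) = g p + g q + (\<Sum>i\<in>{..<d} - {p, q}. g i)"
proof -
  have "(\<Sum>i<d. g i) = g p + (\<Sum>i\<in>{..<d} - {p}. g i)"
    using assms by (intro sum.remove) auto
  also have "(\<Sum>i\<in>{..<d} - {p}. g i) = g q + (\<Sum>i\<in>{..<d} - {p} - {q}. g i)"
    using assms by (intro sum.remove) auto
  also have "{..<d} - {p} - {q} = {..<d} - {p, q}" by auto
  finally show ?thesis by (simp add: add.assoc)
qed

lemma sum_rot_square:
  fixes x :: "nat \<Rightarrow> real"
  assumes "p < d" "q < d" "p \<noteq> q"
  shows "(\<Sum>i<d. (rot p q \<theta> x i)\<^sup>2) = (\<Sum>i<d. (x i)\<^sup>2)"
proof -
  have "(c * a - s * b)\<^sup>2 + (s * a + c * b)\<^sup>2 = (c\<^sup>2 + s\<^sup>2) * (a\<^sup>2 + b\<^sup>2)" for a b c s :: real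
    by (simp add: power2_eq_square algebra_simps)
  from this[of "cos \<theta>" "x p" "sin \<theta>" "x q"]
  have "(cos \<theta> * x p - sin \<theta> * x q)\<^sup>2 + (sin \<theta> * x p + cos \<theta> * x q)\<^sup>2 = (x p)\<^sup>2 + (x q)\<^sup>2"
    by simp
  moreover have "(\<Sum>i\<in>{..<d} - {p, q}. (rot p q \<theta> x i)\<^sup>2) = (\<Sum>i\<in>{..<d} - {p, q}. (x i)\<^sup>2)"
    by (intro sum.cong refl) (auto simp: rot_def)
  ultimately show ?thesis
    using \<open>p \<noteq> q\<close> unfolding sum_split_pair[OF assms] by (simp add: rot_def)
qed

lemma sum_conj_rot_square:
  fixes f :: "nat \<Rightarrow> nat \<Rightarrow> real"
  assumes "p < d" "q < d" "p \<noteq> q"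
  shows "(\<Sum>i<d. \<Sum>j<d. (conj_rot p q \<theta> f i j)\<^sup>2) = (\<Sum>i<d. \<Sum>j<d. (f i j)\<^sup>2)"
  unfolding conj_rot_def
  by (subst sum.swap, subst sum_rot_square[OF assms], subst sum.swap, subst sum_rot_square[OF assms]) (rule refl)

text \<open>A real rotation does not mix real and imaginary parts, so
  \<open>sum_conj_rot_square\<close> applies to each of them.\<close>

lemma Re_conj_rot: "Re (conj_rot p q \<theta> f i j) = conj_rot p q \<theta> (\<lambda>i j. Re (f i j)) i j"
  and Im_conj_rot: "Im (conj_rot p q \<theta> f i j) = conj_rot p q \<theta> (\<lambda>i j. Im (f i j)) i j"
  by (auto simp: conj_rot_def rot_def)

lemma sum_conj_rot_diag:
  fixes f :: "nat \<Rightarrow> nat \<Rightarrow> real"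
  assumes "p < d" "q < d" "p \<noteq> q"
  shows "(\<Sum>i<d. conj_rot p q \<theta> f i i) = (\<Sum>i<d. f i i)"
proof -
  have "c * (c * a - s * b') - s * (c * b - s * e) + (s * (s * a + c * b') + c * (s * b + c * e)) = (c\<^sup>2 + s\<^sup>2) * (a + e)"
    for a b b' c e s :: real
    by (simp add: power2_eq_square algebra_simps)
  from this[of "cos \<theta>" "f p p" "sin \<theta>" "f p q" "f q p" "f q q"]
  have "conj_rot p q \<theta> f p p + conj_rot p q \<theta> f q q = f p p + f q q"
    using \<open>p \<noteq> q\<close> by (simp add: conj_rot_def rot_def)
  moreover have "(\<Sum>i\<in>{..<d} - {p, q}. conj_rot p q \<theta> f i i) = (\<Sum>i\<in>{..<d} - {p, q}. f i i)"
    by (intro sum.cong refl) (auto simp: conj_rot_def rot_def)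
  ultimately show ?thesis
    unfolding sum_split_pair[OF assms] by simp
qed

lemma sum_rot_adjoint:
  fixes x y :: "nat \<Rightarrow> complex"
  assumes "p < d" "q < d" "p \<noteq> q"
  shows "(\<Sum>i<d. y i * rot p q \<theta> x i) = (\<Sum>i<d. rot p q (- \<theta>) y i * x i)"
proof -
  have "(\<Sum>i\<in>{..<d} - {p, q}. y i * rot p q \<theta> x i) = (\<Sum>i\<in>{..<d} - {p, q}. rot p q (- \<theta>) y i * x i)"
    by (intro sum.cong refl) (auto simp: rot_def)
  then show ?thesis
    using \<open>p \<noteq> q\<close> unfolding sum_split_pair[OF assms] by (simp add: rot_def algebra_simps)
qed

lemma cnj_rot: "cnj (rot p q \<theta> x i) = rot p q \<theta> (\<lambda>i. cnj (x i)) i"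
  by (simp add: rot_def)

text \<open>The form of U f U^T at \<open>x\<close> is the form of \<open>f\<close> at
  \<open>y = U^T x\<close>. The transpose is the rotation by \<open>- \<theta>\<close>, moved across
  one index at a time by \<open>sum_rot_adjoint\<close>.\<close>

lemma psd_kernel_conj_rot:
  assumes f: "psd_kernel d f" and pq: "p < d" "q < d" "p \<noteq> q"
  shows "psd_kernel d (conj_rot p q \<theta> f)"
  unfolding psd_kernel_def
proof (intro conjI allI impI)
  fix i j assume "i < d" "j < d"
  then show "conj_rot p q \<theta> f j i = cnj (conj_rot p q \<theta> f i j)"
    using pq by (auto simp: conj_rot_def rot_def algebra_simps simp flip: psd_kernel_cnj[OF f])
next
  fix x :: "nat \<Rightarrow> complex"
  define y where "y = rot p q (- \<theta>) x"
  have "(\<Sum>i<d. \<Sum>j<d. cnj (x i) * conj_rot p q \<theta> f i j * x j)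
      = (\<Sum>j<d. x j * (\<Sum>i<d. cnj (x i) * rot p q \<theta> (\<lambda>k. rot p q \<theta> (f k) j) i))"
    unfolding conj_rot_def sum_distrib_left by (subst sum.swap) (simp add: mult_ac)
  also have "\<dots> = (\<Sum>j<d. x j * (\<Sum>i<d. cnj (y i) * rot p q \<theta> (f i) j))"
    unfolding sum_rot_adjoint[OF pq] y_def cnj_rot ..
  also have "\<dots> = (\<Sum>i<d. cnj (y i) * (\<Sum>j<d. x j * rot p q \<theta> (f i) j))"
    unfolding sum_distrib_left by (subst sum.swap) (simp add: mult_ac)
  also have "\<dots> = (\<Sum>i<d. \<Sum>j<d. cnj (y i) * f i j * y j)"
    unfolding sum_rot_adjoint[OF pq] y_def[symmetric] sum_distrib_left by (simp add: mult_ac)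
  finally show "0 \<le> Re (\<Sum>i<d. \<Sum>j<d. cnj (x i) * conj_rot p q \<theta> f i j * x j)"
    using psd_kernel_form[OF f] by simp
qed

text \<open>Rotating a pair of diagonal entries on opposite sides of the mean \<open>1 / d\<close> until one of them equals
  the mean lowers the number of entries off the mean; the sum of squares varies continuously on the way.\<close>
lemma psd_kernel_prescribe_diag:
  assumes "psd_kernel d f" "(\<Sum>i<d. Re (f i i)) = 1" "1 / real d \<le> \<delta>" "\<delta> \<le> (\<Sum>i<d. (Re (f i i))\<^sup>2)"
  shows "\<exists>g. psd_kernel d g \<and> (\<Sum>i<d. Re (g i i)) = 1 \<and> (\<Sum>i<d. (Re (g i i))\<^sup>2) = \<delta> \<and>
    (\<Sum>i<d. \<Sum>j<d. (Re (g i j))\<^sup>2) = (\<Sum>i<d. \<Sum>j<d. (Re (f i j))\<^sup>2) \<and>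
    (\<Sum>i<d. \<Sum>j<d. (Im (g i j))\<^sup>2) = (\<Sum>i<d. \<Sum>j<d. (Im (f i j))\<^sup>2)"
  using assms
proof (induction "card {i. i < d \<and> Re (f i i) \<noteq> 1 / real d}" arbitrary: f rule: less_induct)
  case less
  have tr: "(\<Sum>i<d. Re (f i i)) = 1" by fact
  then have "d > 0" by (cases d) auto
  show ?case
  proof (cases "\<delta> = (\<Sum>i<d. (Re (f i i))\<^sup>2)")
    case True
    then show ?thesis using less.prems by blast
  next
    case False
    have mean: "(\<Sum>i<d. 1 / real d) = 1" using \<open>d > 0\<close> by simp
    \<comment> \<open>A diagonal constantly equal to the mean has sum of squares
      \<open>1 / real d\<close>, which would force equality with \<open>\<delta>\<close>.\<close>
    obtain k where k: "k < d" "Re (f k k) \<noteq> 1 / real d"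
    proof (rule ccontr)
      assume "\<not> thesis"
      then have "\<forall>i<d. Re (f i i) = 1 / real d" using that by blast
      then have "(\<Sum>i<d. (Re (f i i))\<^sup>2) = 1 / real d"
        using \<open>d > 0\<close> by (simp add: power2_eq_square)
      then show False using False less.prems by linarith
    qed
    obtain p where p: "p < d" "Re (f p p) > 1 / real d"
    proof (rule ccontr)
      assume "\<not> thesis"
      then have le: "\<forall>i<d. Re (f i i) \<le> 1 / real d" using that by force
      then have "(\<Sum>i<d. Re (f i i)) < (\<Sum>i<d. 1 / real d)"
        using k by (intro sum_strict_mono_ex1) (auto simp: less_le intro!: bexI[of _ k])
      then show False using tr mean by simp
    qed
    obtain q where q: "q < d" "Re (f q q) < 1 / real d"
    proof (rule ccontr)
      assume "\<not> thesis"
      then have le: "\<forall>i<d. Re (f i i) \<ge> 1 / real d" using that by force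
      then have "(\<Sum>i<d. 1 / real d) < (\<Sum>i<d. Re (f i i))"
        using k by (intro sum_strict_mono_ex1) (auto simp: less_le intro!: bexI[of _ k])
      then show False using tr mean by simp
    qed
    have pq: "p < d" "q < d" "p \<noteq> q" using p q by auto
    define h where "h \<theta> i = Re (conj_rot p q \<theta> f i i)" for \<theta> i
    have cont: "continuous_on A (\<lambda>\<theta>. h \<theta> i)" for A i
      unfolding h_def conj_rot_def rot_def
      by (cases "i = p"; cases "i = q") (auto intro!: continuous_intros)
    have h0: "h 0 i = Re (f i i)" for i by (simp add: h_def conj_rot_def rot_def)
    \<comment> \<open>A quarter turn brings the entry at \<open>q\<close> to position
      \<open>p\<close>, so between the angles 0 and \<open>pi / 2\<close> the entry at
      \<open>p\<close> crosses the mean.\<close>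
    have "h (pi / 2) p = Re (f q q)" using pq by (simp add: h_def conj_rot_def rot_def)
    then obtain \<theta> where \<theta>: "0 \<le> \<theta>" "h \<theta> p = 1 / real d"
      using IVT2'[of "\<lambda>\<theta>. h \<theta> p" "pi / 2" "1 / real d" 0, OF _ _ _ cont] p q h0 by auto
    let ?Q = "\<lambda>\<theta>. \<Sum>i<d. (h \<theta> i)\<^sup>2"
    have psd: "psd_kernel d (conj_rot p q \<phi> f)" for \<phi>
      by (rule psd_kernel_conj_rot[OF less.prems(1) pq])
    have trr: "(\<Sum>i<d. Re (conj_rot p q \<phi> f i i)) = 1" for \<phi>
      unfolding Re_conj_rot sum_conj_rot_diag[OF pq] by (rule tr)
    have inv: "(\<Sum>i<d. \<Sum>j<d. (Re (conj_rot p q \<phi> f i j))\<^sup>2) = (\<Sum>i<d. \<Sum>j<d. (Re (f i j))\<^sup>2)"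
      "(\<Sum>i<d. \<Sum>j<d. (Im (conj_rot p q \<phi> f i j))\<^sup>2) = (\<Sum>i<d. \<Sum>j<d. (Im (f i j))\<^sup>2)" for \<phi>
      unfolding Re_conj_rot Im_conj_rot sum_conj_rot_square[OF pq] by (rule refl)+
    show ?thesis
    \<comment> \<open>Either the sum of squares has fallen to \<open>\<delta>\<close> or below, and
      some angle on the way hits it exactly, or the rotated kernel goes to the induction
      hypothesis.\<close>
    proof (cases "?Q \<theta> \<le> \<delta>")
      case True
      have "\<exists>\<phi>\<ge>0. \<phi> \<le> \<theta> \<and> ?Q \<phi> = \<delta>"
        using True less.prems(4) \<theta>(1) cont
        by (intro IVT2') (auto simp: h0 intro!: continuous_intros)
      then obtain \<phi> where "?Q \<phi> = \<delta>" by blast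
      then show ?thesis
        using psd[of \<phi>] trr[of \<phi>] inv[of \<phi>] unfolding h_def by blast
    next
      case False
      define off where "off g = {i. i < d \<and> Re (g i i) \<noteq> 1 / real d}" for g :: "nat \<Rightarrow> nat \<Rightarrow> complex"
      have same: "Re (conj_rot p q \<theta> f i i) = Re (f i i)" if "i \<noteq> p" "i \<noteq> q" for i
        using that by (simp add: conj_rot_def rot_def)
      \<comment> \<open>Position \<open>p\<close> has reached the mean, and \<open>q\<close> was off
        it before, so no new index leaves the mean.\<close>
      have "off (conj_rot p q \<theta> f) \<subset> off f"
      proof (rule psubsetI)
        show "off (conj_rot p q \<theta> f) \<subseteq> off f"
        proof
          fix i assume "i \<in> off (conj_rot p q \<theta> f)"
          then show "i \<in> off f"
            using p q same[of i] by (cases "i = p"; cases "i = q") (simp_all add: off_def)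
        qed
        have "p \<in> off f" "p \<notin> off (conj_rot p q \<theta> f)"
          using p \<theta>(2) by (simp_all add: off_def h_def)
        then show "off (conj_rot p q \<theta> f) \<noteq> off f" by metis
      qed
      then have "card (off (conj_rot p q \<theta> f)) < card (off f)"
        by (intro psubset_card_mono) (simp_all add: off_def)
      then have "card {i. i < d \<and> Re (conj_rot p q \<theta> f i i) \<noteq> 1 / real d} < card {i. i < d \<and> Re (f i i) \<noteq> 1 / real d}"
        unfolding off_def .
      from less.hyps[OF this psd trr less.prems(3)] False show ?thesis
        unfolding inv h_def by simp
    qed
  qed
qed

section \<open>Kernels with diagonal real part\<close>

lemma psd_kernel_gramI:
  assumes f: "\<And>i j. i < d \<Longrightarrow> j < d \<Longrightarrow> f i j = (\<Sum>k<n. w k i * cnj (w k j))"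
  shows "psd_kernel d f"
  unfolding psd_kernel_def
proof (intro conjI allI impI)
  show "f j i = cnj (f i j)" if "i < d" "j < d" for i j
    unfolding f[OF that] f[OF that(2,1)] cnj_sum by (intro sum.cong refl) simp
  fix x :: "nat \<Rightarrow> complex"
  have "(\<Sum>i<d. \<Sum>j<d. cnj (x i) * f i j * x j)
      = (\<Sum>i<d. \<Sum>j<d. \<Sum>k<n. (cnj (x i) * w k i) * cnj (cnj (x j) * w k j))"
    by (intro sum.cong refl) (simp add: f sum_distrib_left sum_distrib_right mult_ac)
  also have "\<dots> = (\<Sum>k<n. (\<Sum>i<d. cnj (x i) * w k i) * cnj (\<Sum>i<d. cnj (x i) * w k i))"
    unfolding cnj_sum sum_product by (rule sum_rotate3)
  also have "\<dots> = of_real (\<Sum>k<n. (cmod (\<Sum>i<d. cnj (x i) * w k i))\<^sup>2)"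
    by (simp only: complex_norm_square[symmetric] of_real_sum)
  finally show "0 \<le> Re (\<Sum>i<d. \<Sum>j<d. cnj (x i) * f i j * x j)"
    by (simp add: sum_nonneg del: cnj_sum)
qed

text \<open>The scaled kernel is the convex combination of \<open>f\<close> and its entrywise
  conjugate with weights \<open>(1 + c) / 2\<close> and \<open>(1 - c) / 2\<close>. The form of the
  conjugate kernel at \<open>x\<close> is the conjugate of the form of \<open>f\<close> at the
  conjugate of \<open>x\<close>.\<close>

lemma psd_kernel_scale_Im:
  assumes f: "psd_kernel d f" and c: "0 \<le> c" "c \<le> 1"
  shows "psd_kernel d (\<lambda>i j. Complex (Re (f i j)) (c * Im (f i j)))"
  unfolding psd_kernel_def
proof (intro conjI allI impI)
  show "Complex (Re (f j i)) (c * Im (f j i)) = cnj (Complex (Re (f i j)) (c * Im (f i j)))" if "i < d" "j < d" for i j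
    unfolding psd_kernel_cnj[OF f that] by (simp add: complex_eq_iff)
  fix x :: "nat \<Rightarrow> complex"
  have split: "Complex (Re z) (c * Im z) = of_real ((1 + c) / 2) * z + of_real ((1 - c) / 2) * cnj z" for z
    by (simp add: complex_eq_iff field_simps)
  have "(\<Sum>i<d. \<Sum>j<d. cnj (x i) * Complex (Re (f i j)) (c * Im (f i j)) * x j) =
    of_real ((1 + c) / 2) * (\<Sum>i<d. \<Sum>j<d. cnj (x i) * f i j * x j) +
    of_real ((1 - c) / 2) * (\<Sum>i<d. \<Sum>j<d. cnj (x i) * cnj (f i j) * x j)"
    unfolding split sum_distrib_left sum.distrib[symmetric] by (intro sum.cong refl) (simp add: algebra_simps)
  also have "(\<Sum>i<d. \<Sum>j<d. cnj (x i) * cnj (f i j) * x j) = cnj (\<Sum>i<d. \<Sum>j<d. cnj (cnj (x i)) * f i j * cnj (x j))"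
    by simp
  finally have "Re (\<Sum>i<d. \<Sum>j<d. cnj (x i) * Complex (Re (f i j)) (c * Im (f i j)) * x j) =
    (1 + c) / 2 * Re (\<Sum>i<d. \<Sum>j<d. cnj (x i) * f i j * x j) +
    (1 - c) / 2 * Re (\<Sum>i<d. \<Sum>j<d. cnj (cnj (x i)) * f i j * cnj (x j))"
    by (simp only: plus_complex.sel cnj.sel Re_complex_of_real Im_complex_of_real times_complex.sel mult_zero_left diff_zero)
  then show "0 \<le> Re (\<Sum>i<d. \<Sum>j<d. cnj (x i) * Complex (Re (f i j)) (c * Im (f i j)) * x j)"
    using c psd_kernel_form[OF f, of x] psd_kernel_form[OF f, of "\<lambda>i. cnj (x i)"]
    by (simp only:) (intro add_nonneg_nonneg mult_nonneg_nonneg; simp)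
qed

text \<open>Exchanges \<open>2 k\<close> and \<open>2 k + 1\<close>, the indices of one block. For
  odd \<open>d\<close> the partner of the last index is \<open>d\<close>, out of range.\<close>

definition partner :: "nat \<Rightarrow> nat" where
  "partner i = (if even i then i + 1 else i - 1)"

lemma partner_iff: "i div 2 = j div 2 \<and> i \<noteq> j \<longleftrightarrow> j = partner i"
  unfolding partner_def by (cases "even i") presburger+

text \<open>The factor \<open>\<i>\<close> at odd indices makes the products within a block real on
  the diagonal and purely imaginary off it.\<close>

definition block_vec :: "(nat \<Rightarrow> real) \<Rightarrow> nat \<Rightarrow> complex" where
  "block_vec r i = of_real (sqrt (r i)) * (if even i then 1 else \<i>)"

text \<open>Block diagonal matrix whose \<open>2 \<times> 2\<close> blocks are the rank one matrices
  \<open>((a, -\<i> \<surd>(ab)), (\<i> \<surd>(ab), b))\<close>.\<close>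
definition block_kernel :: "(nat \<Rightarrow> real) \<Rightarrow> nat \<Rightarrow> nat \<Rightarrow> complex" where
  "block_kernel r i j = (if i div 2 = j div 2 then block_vec r i * cnj (block_vec r j) else 0)"

text \<open>For nonnegative \<open>r\<close>, the squared Frobenius norm of the imaginary part of
  \<open>block_kernel r\<close>; each full block is counted from both of its indices.\<close>

definition pair_sum :: "nat \<Rightarrow> (nat \<Rightarrow> real) \<Rightarrow> real" where
  "pair_sum d r = (\<Sum>i<d. if partner i < d then r i * r (partner i) else 0)"

lemma psd_kernel_block_kernel: "psd_kernel d (block_kernel r)"
proof (rule psd_kernel_gramI)
  fix i j assume "i < d" "j < d"
  define w where "w k i = (if k = i div 2 then block_vec r i else 0)" for k i
  have "(\<Sum>k<d. w k i * cnj (w k j)) = (\<Sum>k<d. if k = i div 2 then block_kernel r i j else 0)"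
    by (intro sum.cong refl) (auto simp: w_def block_kernel_def)
  also have "\<dots> = block_kernel r i j" using \<open>i < d\<close> by simp
  finally show "block_kernel r i j = (\<Sum>k<d. w k i * cnj (w k j))" ..
qed

lemma block_parity: "i div 2 = j div 2 \<Longrightarrow> i \<noteq> j \<Longrightarrow> even j \<longleftrightarrow> odd i" for i j :: nat
  by presburger

lemma Re_block_kernel:
  assumes "0 \<le> r i"
  shows "Re (block_kernel r i j) = (if i = j then r i else 0)"
proof (cases "i = j")
  case True
  then show ?thesis using assms by (cases "even j") (simp_all add: block_kernel_def block_vec_def)
next
  case False
  show ?thesis
  proof (cases "i div 2 = j div 2")
    case True
    show ?thesis
      using block_parity[OF True False] False by (cases "even i") (simp_all add: block_kernel_def block_vec_def)
  qed (use False in \<open>simp add: block_kernel_def\<close>)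
qed

lemma Im_block_kernel:
  assumes "0 \<le> r i" "0 \<le> r j"
  shows "(Im (block_kernel r i j))\<^sup>2 = (if j = partner i then r i * r j else 0)"
proof (cases "j = partner i")
  case True
  then have ij: "i div 2 = j div 2" "i \<noteq> j" using partner_iff by blast+
  have "(Im (block_kernel r i j))\<^sup>2 = r i * r j"
    using block_parity[OF ij] ij(1) assms
    by (cases "even i") (simp_all add: block_kernel_def block_vec_def power_mult_distrib)
  then show ?thesis by (subst if_P[OF True])
next
  case False
  then have "i = j \<or> i div 2 \<noteq> j div 2" using partner_iff by blast
  then have "Im (block_kernel r i j) = 0"
    by (cases "even j") (auto simp: block_kernel_def block_vec_def)
  then show ?thesis using False by simp
qed

lemma sum_Im_block_kernel:
  assumes "\<And>i. 0 \<le> r i"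
  shows "(\<Sum>i<d. \<Sum>j<d. (Im (block_kernel r i j))\<^sup>2) = pair_sum d r"
  by (simp add: Im_block_kernel assms pair_sum_def)

lemma psd_kernel_of_spectrum:
  assumes r: "\<And>i. 0 \<le> r i" and K: "0 \<le> K" "K \<le> pair_sum d r"
  shows "\<exists>f. psd_kernel d f \<and> (\<forall>i j. Re (f i j) = (if i = j then r i else 0)) \<and>
    (\<Sum>i<d. \<Sum>j<d. (Im (f i j))\<^sup>2) = K"
proof -
  \<comment> \<open>If \<open>pair_sum d r = 0\<close>, then \<open>K = 0\<close> as well and the
    division by zero gives the right value \<open>c = 0\<close>.\<close>
  define c where "c = sqrt (K / pair_sum d r)"
  have c: "0 \<le> c" "c \<le> 1" "c\<^sup>2 * pair_sum d r = K"
    using K by (auto simp: c_def divide_le_eq_1)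
  define f where "f i j = Complex (Re (block_kernel r i j)) (c * Im (block_kernel r i j))" for i j
  have "psd_kernel d f"
    unfolding f_def by (rule psd_kernel_scale_Im[OF psd_kernel_block_kernel c(1,2)])
  moreover have "(\<Sum>i<d. \<Sum>j<d. (Im (f i j))\<^sup>2) = c\<^sup>2 * (\<Sum>i<d. \<Sum>j<d. (Im (block_kernel r i j))\<^sup>2)"
    by (simp add: f_def power_mult_distrib sum_distrib_left)
  then have "(\<Sum>i<d. \<Sum>j<d. (Im (f i j))\<^sup>2) = K"
    unfolding sum_Im_block_kernel[OF r] c(3) .
  moreover have "\<forall>i j. Re (f i j) = (if i = j then r i else 0)"
    by (simp add: f_def Re_block_kernel r)
  ultimately show ?thesis by blast
qed

section \<open>Spectra with a prescribed sum of squares\<close>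

lemma sum_div2: "(\<Sum>i<2 * m. g (i div 2)) = 2 * (\<Sum>k<m. g k)" for g :: "nat \<Rightarrow> real"
  by (induction m) auto

text \<open>Equal eigenvalues within a block turn the product of partners into a square, so the
  imaginary part matches the real part on all full blocks. For \<open>e = 1\<close> the eigenvalue
  \<open>a\<close> is left without a partner.\<close>

lemma paired_spectrum:
  fixes p :: "nat \<Rightarrow> real" and a :: real
  assumes d: "d = 2 * m + e" "e \<le> 1"
  defines "r \<equiv> \<lambda>i. if i < 2 * m then p (i div 2) else a"
  shows "(\<Sum>i<d. r i) = 2 * (\<Sum>k<m. p k) + real e * a"
    and "(\<Sum>i<d. (r i)\<^sup>2) = 2 * (\<Sum>k<m. (p k)\<^sup>2) + real e * a\<^sup>2"
    and "pair_sum d r = 2 * (\<Sum>k<m. (p k)\<^sup>2)"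
proof -
  have split: "(\<Sum>i<d. g i) = (\<Sum>i<2 * m. g i) + (if e = 1 then g (2 * m) else 0)" for g :: "nat \<Rightarrow> real"
    using d by (cases e) auto
  have "(\<Sum>i<2 * m. r i) = (\<Sum>i<2 * m. p (i div 2))" by (intro sum.cong) (auto simp: r_def)
  then show "(\<Sum>i<d. r i) = 2 * (\<Sum>k<m. p k) + real e * a"
    using d(2) unfolding split sum_div2 by (cases e) (auto simp: r_def)
  have "(\<Sum>i<2 * m. (r i)\<^sup>2) = (\<Sum>i<2 * m. (p (i div 2))\<^sup>2)" by (intro sum.cong) (auto simp: r_def)
  then show "(\<Sum>i<d. (r i)\<^sup>2) = 2 * (\<Sum>k<m. (p k)\<^sup>2) + real e * a\<^sup>2"
    using d(2) unfolding split sum_div2[of "\<lambda>k. (p k)\<^sup>2"] by (cases e) (auto simp: r_def)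
  have "partner i < 2 * m" "partner i div 2 = i div 2" if "i < 2 * m" for i
    using that unfolding partner_def by (cases "even i"; auto elim!: evenE oddE)+
  moreover from this(1) have "partner i < d" if "i < 2 * m" for i
    using that d by fastforce
  ultimately have "(\<Sum>i<2 * m. if partner i < d then r i * r (partner i) else 0) = (\<Sum>i<2 * m. (p (i div 2))\<^sup>2)"
    by (intro sum.cong refl) (simp add: r_def power2_eq_square)
  moreover have "\<not> partner (2 * m) < d" using d by (simp add: partner_def)
  ultimately show "pair_sum d r = 2 * (\<Sum>k<m. (p k)\<^sup>2)"
    unfolding pair_sum_def split sum_div2[of "\<lambda>k. (p k)\<^sup>2"] by simp
qed

text \<open>With one nonzero block, \<open>pair_sum\<close> is the cross term
  \<open>2 c (1 - c)\<close> of \<open>(c + (1 - c))^2 = 1\<close>. The block kernel is then a pure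
  state, the boundary case of (i).\<close>

lemma spectrum_pure:
  assumes "d \<ge> 2" "1 / 2 \<le> A" "A \<le> 1"
  shows "\<exists>r. (\<forall>i. 0 \<le> r i) \<and> (\<Sum>i<d. r i) = 1 \<and> (\<Sum>i<d. (r i)\<^sup>2) = A \<and> pair_sum d r = 1 - A"
proof -
  \<comment> \<open>The larger root of \<open>c^2 + (1 - c)^2 = A\<close>, real because
    \<open>A >= 1 / 2\<close>.\<close>
  define c where "c = (1 + sqrt (2 * A - 1)) / 2"
  have c: "0 \<le> c" "c \<le> 1" using assms by (auto simp: c_def)
  have "(sqrt (2 * A - 1))\<^sup>2 = 2 * A - 1" using assms by simp
  then have A: "A = c\<^sup>2 + (1 - c)\<^sup>2"
    by (simp add: c_def power2_eq_square field_simps)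
  define r where "r i = (if i = 0 then c else if i = 1 then 1 - c else 0)" for i :: nat
  have split: "(\<Sum>i<d. g i) = g 0 + g 1 + (\<Sum>i\<in>{..<d} - {0, 1}. g i)" for g :: "nat \<Rightarrow> real"
    using assms by (intro sum_split_pair) auto
  have "(\<Sum>i<d. r i) = 1" "(\<Sum>i<d. (r i)\<^sup>2) = A"
    unfolding split by (auto simp: r_def A)
  moreover have "(\<Sum>i\<in>{..<d} - {0, 1}. if partner i < d then r i * r (partner i) else 0) = 0"
    by (intro sum.neutral) (auto simp: r_def)
  then have "pair_sum d r = 1 - A"
    using assms(1) unfolding pair_sum_def split
    by (simp add: r_def partner_def A power2_eq_square algebra_simps)
  ultimately show ?thesis using c by (intro exI[of _ r]) (auto simp: r_def)
qed

text \<open>Eigenvalues in equal pairs give the boundary case of (ii). One pair carries the weight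
  \<open>x\<close> and the other \<open>m - 1\<close> pairs share the rest equally; for
  \<open>e = 1\<close> the leftover eigenvalue is 0.\<close>

lemma spectrum_paired:
  assumes "m \<ge> 1" and d: "d = 2 * m + e" "e \<le> 1" and A: "1 / real (2 * m) \<le> A" "A < 1 / 2"
  shows "\<exists>r. (\<forall>i. 0 \<le> r i) \<and> (\<Sum>i<d. r i) = 1 \<and> (\<Sum>i<d. (r i)\<^sup>2) = A \<and> pair_sum d r = A"
proof -
  obtain n where n: "m = Suc n" using \<open>m \<ge> 1\<close> by (cases m) auto
  \<comment> \<open>For \<open>m = 1\<close> the interval for \<open>A\<close> is empty.\<close>
  have "n > 0" using A n by (cases n) auto
  define F where "F x = (x\<^sup>2 + (1 - x)\<^sup>2 / real n) / 2" for x :: real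
  \<comment> \<open>At \<open>x = 1 / m\<close> all pairs are equal, at \<open>x = 1\<close> only
    one is nonzero; the intermediate value theorem reaches every \<open>A\<close> in
    between.\<close>
  have "F (1 / real m) = 1 / real (2 * m)"
  proof -
    have "1 - 1 / real m = real n / real m" by (simp add: n field_simps)
    then have "F (1 / real m) = ((1 / real m)\<^sup>2 + real n / (real m)\<^sup>2) / 2"
      using \<open>n > 0\<close> by (simp add: F_def power2_eq_square)
    also have "(1 / real m)\<^sup>2 + real n / (real m)\<^sup>2 = real m / (real m)\<^sup>2"
      by (simp only: power_divide power_one add_divide_distrib[symmetric] n of_nat_Suc)
    finally show ?thesis by (simp add: n power2_eq_square)
  qed
  moreover have "F 1 = 1 / 2" by (simp add: F_def)
  moreover have "continuous_on {1 / real m..1} F"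
    unfolding F_def by (intro continuous_intros) (use \<open>n > 0\<close> in auto)
  ultimately obtain x where x: "1 / real m \<le> x" "x \<le> 1" "F x = A"
    using IVT'[of F "1 / real m" A 1] A \<open>m \<ge> 1\<close> by auto
  have "0 \<le> x" using x(1) by (rule order.trans[rotated]) simp
  define p where "p k = (if k = 0 then x else (1 - x) / real n) / 2" for k :: nat
  have sums: "2 * (\<Sum>k<m. p k) = 1" "2 * (\<Sum>k<m. (p k)\<^sup>2) = A"
    unfolding n sum.lessThan_Suc_shift x(3)[symmetric] using \<open>n > 0\<close>
    by (simp_all add: p_def F_def power2_eq_square field_simps)
  show ?thesis
    using paired_spectrum[OF d, of p 0] sums \<open>0 \<le> x\<close> \<open>x \<le> 1\<close>
    by (intro exI[of _ "\<lambda>i. if i < 2 * m then p (i div 2) else 0"]) (auto simp: p_def)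
qed

text \<open>The spectrum \<open>b, ..., b, a\<close> attains equality in
  \<open>frobenius_ge_unit_vector\<close> with \<open>v\<close> the eigenvector of the unpaired
  \<open>a\<close>; the pairs contribute everything except \<open>a^2\<close>.\<close>

lemma spectrum_odd:
  assumes "m \<ge> 1" and d: "d = 2 * m + 1" and A: "1 / real d \<le> A" "A < 1 / real (2 * m)"
  shows "\<exists>r. (\<forall>i. 0 \<le> r i) \<and> (\<Sum>i<d. r i) = 1 \<and> (\<Sum>i<d. (r i)\<^sup>2) = A \<and>
    pair_sum d r = ((sqrt (real d - 1) + sqrt (real d * A - 1)) / real d)\<^sup>2"
proof -
  define s where "s = sqrt (real d - 1)"
  define t where "t = sqrt (real d * A - 1)"
  \<comment> \<open>\<open>a\<close> and \<open>b\<close> solve \<open>2 m b + a = 1\<close> and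
    \<open>2 m b^2 + a^2 = A\<close>, where \<open>real d = s^2 + 1\<close> and
    \<open>real d * A = 1 + t^2\<close>; the smaller root is taken for \<open>a\<close>.\<close>
  define a where "a = (1 - s * t) / real d"
  define b where "b = (s + t) / (s * real d)"
  have s: "s > 0" "s\<^sup>2 = 2 * real m" using assms by (auto simp: s_def)
  have "real d * A - 1 \<ge> 0" using A d by (simp add: field_simps)
  then have t: "t \<ge> 0" "t\<^sup>2 = real d * A - 1" by (auto simp: t_def)
  have dd: "real d = s\<^sup>2 + 1" "s\<^sup>2 + 1 > 0" using s d by auto
  \<comment> \<open>The upper bound on \<open>A\<close> enters here and makes \<open>a\<close>
    nonnegative.\<close>
  have "(s * t)\<^sup>2 \<le> 1"
  proof -
    have "A * s\<^sup>2 < 1" using A \<open>m \<ge> 1\<close> by (simp add: s field_simps)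
    then have "s\<^sup>2 * t\<^sup>2 < s\<^sup>2 + 1 - s\<^sup>2"
      unfolding t(2) dd(1) using mult_strict_left_mono[of "A * s\<^sup>2" 1 "s\<^sup>2 + 1"] dd(2)
      by (simp add: algebra_simps)
    then show ?thesis by (simp add: power_mult_distrib)
  qed
  then have "s * t \<le> 1" using power2_le_imp_le[of "s * t" 1] by simp
  then have nonneg: "a \<ge> 0" "b \<ge> 0" using s t by (auto simp: a_def b_def)
  have 1: "real (2 * m) * b + a = 1"
  proof -
    have "real (2 * m) * b = s * (s + t) / real d" using s(1) by (simp add: b_def s(2)[symmetric] power2_eq_square)
    then show ?thesis using dd by (simp add: a_def power2_eq_square field_simps)
  qed
  have 2: "real (2 * m) * b\<^sup>2 = ((s + t) / real d)\<^sup>2"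
    using s(1) by (simp add: b_def s(2)[symmetric] power_divide power_mult_distrib)
  have "((s + t) / real d)\<^sup>2 + a\<^sup>2 = ((s + t)\<^sup>2 + (1 - s * t)\<^sup>2) / (real d)\<^sup>2"
    by (simp only: a_def power_divide add_divide_distrib[symmetric])
  also have "(s + t)\<^sup>2 + (1 - s * t)\<^sup>2 = real d * (1 + t\<^sup>2)"
    unfolding dd(1) by (simp add: power2_eq_square algebra_simps)
  also have "1 + t\<^sup>2 = real d * A" by (simp add: t(2))
  also have "real d * (real d * A) / (real d)\<^sup>2 = A" using d by (simp add: power2_eq_square)
  finally have 3: "((s + t) / real d)\<^sup>2 + a\<^sup>2 = A" .
  show ?thesis
    using paired_spectrum[of d m 1 "\<lambda>_. b" a] d 1 2 3 nonneg unfolding s_def[symmetric] t_def[symmetric]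
    by (intro exI[of _ "\<lambda>i. if i < 2 * m then b else a"]) auto
qed

section \<open>Quantum states\<close>

text \<open>The partial order on complex numbers demands that form and trace be real, which
  Hermitian symmetry provides.\<close>

lemma quantum_state_mat_iff:
  "quantum_state d (mat d d (\<lambda>(i, j). f i j)) \<longleftrightarrow> psd_kernel d f \<and> (\<Sum>i<d. Re (f i i)) = 1"
proof -
  define A where "A = mat d d (\<lambda>(i, j). f i j)"
  have A: "A \<in> carrier_mat d d" "\<And>i j. i < d \<Longrightarrow> j < d \<Longrightarrow> A $$ (i, j) = f i j"
    by (auto simp: A_def)
  have adj: "mat_adjoint A = A \<longleftrightarrow> (\<forall>i<d. \<forall>j<d. f j i = cnj (f i j))"
  proof
    assume *: "mat_adjoint A = A"
    show "\<forall>i<d. \<forall>j<d. f j i = cnj (f i j)"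
    proof (intro allI impI)
      fix i j assume "i < d" "j < d"
      then show "f j i = cnj (f i j)"
        using mat_adjoint_index[OF A(1), of j i] unfolding * by (simp add: A(2))
    qed
  next
    assume *: "\<forall>i<d. \<forall>j<d. f j i = cnj (f i j)"
    show "mat_adjoint A = A"
    proof (rule eq_matI)
      fix i j assume "i < dim_row A" "j < dim_col A"
      then have ij: "i < d" "j < d" by (auto simp: A_def)
      then have "f i j = cnj (f j i)" using * by blast
      then show "mat_adjoint A $$ (i, j) = A $$ (i, j)"
        using mat_adjoint_index[OF A(1) ij] ij by (simp only: A(2)) simp
    qed (use A(1) in \<open>auto simp: mat_adjoint_def mat_of_rows_def\<close>)
  qed
  have form: "(A *\<^sub>v v) \<bullet>c v = (\<Sum>i<d. \<Sum>j<d. cnj (v $ i) * f i j * v $ j)" if "v \<in> carrier_vec d" for v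
    using that A(1) by (simp add: scalar_prod_def atLeast0LessThan A(2) sum_distrib_left mult_ac)
  have nonneg: "(\<forall>v \<in> carrier_vec d. 0 \<le> (A *\<^sub>v v) \<bullet>c v) \<longleftrightarrow>
      (\<forall>x. 0 \<le> Re (\<Sum>i<d. \<Sum>j<d. cnj (x i) * f i j * x j))"
    if herm: "\<forall>i<d. \<forall>j<d. f j i = cnj (f i j)"
  proof
    assume *: "\<forall>v \<in> carrier_vec d. 0 \<le> (A *\<^sub>v v) \<bullet>c v"
    show "\<forall>x. 0 \<le> Re (\<Sum>i<d. \<Sum>j<d. cnj (x i) * f i j * x j)"
    proof
      fix x :: "nat \<Rightarrow> complex"
      have "0 \<le> (A *\<^sub>v vec d x) \<bullet>c vec d x" using * by simp
      then have "0 \<le> Re (\<Sum>i<d. \<Sum>j<d. cnj (vec d x $ i) * f i j * vec d x $ j)"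
        unfolding form[OF vec_carrier] less_eq_complex_def by (simp only: zero_complex.sel)
      also have "(\<Sum>i<d. \<Sum>j<d. cnj (vec d x $ i) * f i j * vec d x $ j) =
          (\<Sum>i<d. \<Sum>j<d. cnj (x i) * f i j * x j)" by (intro sum.cong refl) simp
      finally show "0 \<le> Re (\<Sum>i<d. \<Sum>j<d. cnj (x i) * f i j * x j)" .
    qed
  next
    assume *: "\<forall>x. 0 \<le> Re (\<Sum>i<d. \<Sum>j<d. cnj (x i) * f i j * x j)"
    show "\<forall>v \<in> carrier_vec d. 0 \<le> (A *\<^sub>v v) \<bullet>c v"
    proof
      fix v :: "complex vec" assume v: "v \<in> carrier_vec d"
      have "Im (\<Sum>i<d. \<Sum>j<d. cnj (v $ i) * f i j * v $ j) = 0"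
        by (rule hermitian_form_real) (use herm in blast)
      moreover have "0 \<le> Re (\<Sum>i<d. \<Sum>j<d. cnj (v $ i) * f i j * v $ j)"
        using * by (rule allE)
      ultimately show "0 \<le> (A *\<^sub>v v) \<bullet>c v"
        unfolding form[OF v] less_eq_complex_def by (simp only: zero_complex.sel)
    qed
  qed
  have psd: "psd_mat d A \<longleftrightarrow> psd_kernel d f"
    unfolding psd_mat_def psd_kernel_def adj using nonneg A(1) by blast
  have "mat_trace A = (\<Sum>i<d. f i i)" by (simp add: mat_trace_def A_def)
  moreover have "Im (\<Sum>i<d. f i i) = 0" if "psd_kernel d f"
    unfolding Im_sum by (intro sum.neutral) (use psd_kernel_Im_diag[OF that] in auto)
  ultimately have "psd_kernel d f \<Longrightarrow> mat_trace A = 1 \<longleftrightarrow> (\<Sum>i<d. Re (f i i)) = 1"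
    by (simp add: complex_eq_iff)
  then show ?thesis unfolding quantum_state_def A_def[symmetric] psd by blast
qed

lemma mat_trace_square:
  assumes "A \<in> carrier_mat d d"
  shows "mat_trace (A * A) = (\<Sum>i<d. \<Sum>j<d. A $$ (i, j) * A $$ (j, i))"
  using assms by (simp add: mat_trace_def scalar_prod_def atLeast0LessThan)

text \<open>Up to the factor \<open>d\<close>, the three parts collect the centred diagonal, the
  real off-diagonal and the imaginary entries of \<open>f\<close>. Each trace is \<open>d^2\<close>
  times a sum of squares, and the normalisation of \<open>S_D\<close>, \<open>S_X\<close> and
  \<open>S_I\<close> removes one factor \<open>d\<close>.\<close>

lemma S_of_kernel:
  assumes psd: "psd_kernel d f" and tr: "(\<Sum>i<d. Re (f i i)) = 1" and "d > 0"
  defines "\<rho> \<equiv> mat d d (\<lambda>(i, j). f i j)"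
  shows "(S_D \<rho>)\<^sup>2 = real d * (\<Sum>i<d. (Re (f i i))\<^sup>2) - 1" (is ?D)
    and "(S_X \<rho>)\<^sup>2 = real d * ((\<Sum>i<d. \<Sum>j<d. (Re (f i j))\<^sup>2) - (\<Sum>i<d. (Re (f i i))\<^sup>2))" (is ?X)
    and "(S_I \<rho>)\<^sup>2 = real d * (\<Sum>i<d. \<Sum>j<d. (Im (f i j))\<^sup>2)" (is ?I)
    and "0 \<le> S_D \<rho>" "0 \<le> S_X \<rho>" "0 \<le> S_I \<rho>"
proof -
  have dim: "dim_row \<rho> = d" "dim_col \<rho> = d" by (auto simp: \<rho>_def)
  have symm: "f i j + f j i = of_real (2 * Re (f i j))" "f i j - f j i = \<i> * of_real (2 * Im (f i j))"
    if "i < d" "j < d" for i j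
    unfolding psd_kernel_cnj[OF psd that] by (simp_all add: complex_eq_iff)
  have diag: "f i i = of_real (Re (f i i))" if "i < d" for i
    using psd_kernel_Im_diag[OF psd that] by (simp add: complex_eq_iff)

  have car: "D_part \<rho> \<in> carrier_mat d d" by (simp add: D_part_def Let_def dim)
  have "mat_trace (D_part \<rho> * D_part \<rho>) = (\<Sum>i<d. \<Sum>j<d. if j = i then (of_nat d * f i i - 1)\<^sup>2 else 0)"
    unfolding mat_trace_square[OF car]
    by (intro sum.cong refl) (auto simp: D_part_def Let_def dim power2_eq_square \<rho>_def)
  also have "\<dots> = (\<Sum>i<d. of_real ((real d * Re (f i i) - 1)\<^sup>2))"
    by (simp, intro sum.cong refl, subst diag) auto
  finally have D: "Re (mat_trace (D_part \<rho> * D_part \<rho>)) = (\<Sum>i<d. (real d * Re (f i i) - 1)\<^sup>2)"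
    by (simp flip: of_real_sum)
  moreover have "0 \<le> \<dots>" by (intro sum_nonneg) auto
  ultimately have D0: "0 \<le> Re (mat_trace (D_part \<rho> * D_part \<rho>))" by simp
  note D
  also have "(\<Sum>i<d. (real d * Re (f i i) - 1)\<^sup>2) = (\<Sum>i<d. (real d)\<^sup>2 * (Re (f i i))\<^sup>2 - 2 * real d * Re (f i i) + 1)"
    by (simp add: power2_eq_square algebra_simps)
  also have "\<dots> = real d * (real d * (\<Sum>i<d. (Re (f i i))\<^sup>2) - 1)"
    by (simp add: sum.distrib sum_subtractf sum_distrib_left[symmetric] tr power2_eq_square algebra_simps)
  finally have D': "Re (mat_trace (D_part \<rho> * D_part \<rho>)) = real d * (real d * (\<Sum>i<d. (Re (f i i))\<^sup>2) - 1)" .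
  show ?D "0 \<le> S_D \<rho>"
    using D0 D' \<open>d > 0\<close> by (simp_all add: S_D_def dim zero_le_mult_iff)

  have car: "X_part \<rho> \<in> carrier_mat d d" by (simp add: X_part_def Let_def dim)
  have "mat_trace (X_part \<rho> * X_part \<rho>) =
      (\<Sum>i<d. \<Sum>j<d. of_real ((real d)\<^sup>2 * (if j = i then 0 else (Re (f i j))\<^sup>2)))"
    unfolding mat_trace_square[OF car]
  proof (intro sum.cong refl)
    fix i j assume "i \<in> {..<d}" "j \<in> {..<d}"
    then have ij: "i < d" "j < d" by auto
    note * = symm(1)[OF ij]
    have **: "f j i + f i j = of_real (2 * Re (f i j))" using * by (simp only: add.commute)
    show "X_part \<rho> $$ (i, j) * X_part \<rho> $$ (j, i) = of_real ((real d)\<^sup>2 * (if j = i then 0 else (Re (f i j))\<^sup>2))"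
      using ij by (simp add: X_part_def Let_def dim power2_eq_square \<rho>_def * **)
  qed
  then have X: "Re (mat_trace (X_part \<rho> * X_part \<rho>)) = (real d)\<^sup>2 * (\<Sum>i<d. \<Sum>j<d. if j = i then 0 else (Re (f i j))\<^sup>2)"
    unfolding sum_distrib_left by (simp flip: of_real_sum)
  have "(\<Sum>i<d. \<Sum>j<d. if j = i then 0 else (Re (f i j))\<^sup>2) =
    (\<Sum>i<d. \<Sum>j<d. (Re (f i j))\<^sup>2 - (if j = i then (Re (f i j))\<^sup>2 else 0))"
    by (intro sum.cong refl) auto
  also have "\<dots> = (\<Sum>i<d. \<Sum>j<d. (Re (f i j))\<^sup>2) - (\<Sum>i<d. (Re (f i i))\<^sup>2)"
    by (simp add: sum_subtractf)
  finally have X': "(\<Sum>i<d. \<Sum>j<d. if j = i then 0 else (Re (f i j))\<^sup>2) =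
    (\<Sum>i<d. \<Sum>j<d. (Re (f i j))\<^sup>2) - (\<Sum>i<d. (Re (f i i))\<^sup>2)" .
  have "0 \<le> (\<Sum>i<d. \<Sum>j<d. if j = i then 0 else (Re (f i j))\<^sup>2)"
    by (intro sum_nonneg) auto
  then show ?X "0 \<le> S_X \<rho>"
    using \<open>d > 0\<close> by (simp_all add: S_X_def dim X X' power2_eq_square)

  have car: "I_part \<rho> \<in> carrier_mat d d" 
    by (rule carrier_matI) (simp_all add: I_part_def \<rho>_def)
  have "mat_trace (I_part \<rho> * I_part \<rho>) =
      (\<Sum>i<d. \<Sum>j<d. (of_nat d / 2)\<^sup>2 * ((f i j - f j i) * (f j i - f i j)))"
    unfolding mat_trace_square[OF car]
    by (intro sum.cong refl) (auto simp: I_part_def power2_eq_square \<rho>_def)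
  also have "\<dots> = (\<Sum>i<d. \<Sum>j<d. of_real ((real d)\<^sup>2 * (Im (f i j))\<^sup>2))"
  proof (intro sum.cong refl)
    fix i j assume "i \<in> {..<d}" "j \<in> {..<d}"
    then have *: "f i j - f j i = \<i> * of_real (2 * Im (f i j))" by (intro symm) auto
    \<comment> \<open>Skew symmetry and the square of \<open>\<i>\<close> each contribute a sign, so
      the product is nonnegative.\<close>
    have "(f i j - f j i) * (f j i - f i j) = - ((f i j - f j i) * (f i j - f j i))" by (simp add: algebra_simps)
    also have "\<dots> = of_real (4 * (Im (f i j))\<^sup>2)"
      unfolding * by (simp add: complex_eq_iff power2_eq_square)
    finally show "(of_nat d / 2)\<^sup>2 * ((f i j - f j i) * (f j i - f i j)) = of_real ((real d)\<^sup>2 * (Im (f i j))\<^sup>2)"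
      by (simp only:) (simp add: power2_eq_square)
  qed
  finally have "Re (mat_trace (I_part \<rho> * I_part \<rho>)) = (real d)\<^sup>2 * (\<Sum>i<d. \<Sum>j<d. (Im (f i j))\<^sup>2)"
    unfolding sum_distrib_left by (simp flip: of_real_sum)
  then show ?I "0 \<le> S_I \<rho>"
    using \<open>d > 0\<close> by (simp_all add: S_I_def dim power2_eq_square sum_nonneg)
qed

lemma state_exists_iff:
  assumes "d > 0" "s_D \<ge> 0" "s_X \<ge> 0" "s_I \<ge> 0"
  shows "(\<exists>\<rho>. quantum_state d \<rho> \<and> (s_D, s_X, s_I) = (S_D \<rho>, S_X \<rho>, S_I \<rho>)) \<longleftrightarrow>
    (\<exists>f. psd_kernel d f \<and> (\<Sum>i<d. Re (f i i)) = 1 \<and>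
      real d * (\<Sum>i<d. (Re (f i i))\<^sup>2) = 1 + s_D\<^sup>2 \<and>
      real d * (\<Sum>i<d. \<Sum>j<d. (Re (f i j))\<^sup>2) = 1 + s_D\<^sup>2 + s_X\<^sup>2 \<and>
      real d * (\<Sum>i<d. \<Sum>j<d. (Im (f i j))\<^sup>2) = s_I\<^sup>2)" (is "?L \<longleftrightarrow> ?R")
proof
  assume ?L
  then obtain \<rho> where \<rho>: "quantum_state d \<rho>" "s_D = S_D \<rho>" "s_X = S_X \<rho>" "s_I = S_I \<rho>" by auto
  define f where "f i j = \<rho> $$ (i, j)" for i j
  have "\<rho> \<in> carrier_mat d d" using \<rho>(1) by (auto simp: quantum_state_def psd_mat_def)
  then have eq: "\<rho> = mat d d (\<lambda>(i, j). f i j)" by (intro eq_matI) (auto simp: f_def)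
  have f: "psd_kernel d f" "(\<Sum>i<d. Re (f i i)) = 1"
    using \<rho>(1) unfolding eq quantum_state_mat_iff by auto
  show ?R
    using f S_of_kernel[OF f \<open>d > 0\<close>] unfolding eq[symmetric] \<rho>(2-4)
    by (intro exI[of _ f]) (simp add: algebra_simps)
next
  assume ?R
  then obtain f where f: "psd_kernel d f" "(\<Sum>i<d. Re (f i i)) = 1"
    and S: "real d * (\<Sum>i<d. (Re (f i i))\<^sup>2) = 1 + s_D\<^sup>2"
      "real d * (\<Sum>i<d. \<Sum>j<d. (Re (f i j))\<^sup>2) = 1 + s_D\<^sup>2 + s_X\<^sup>2"
      "real d * (\<Sum>i<d. \<Sum>j<d. (Im (f i j))\<^sup>2) = s_I\<^sup>2" by blast
  define \<rho> where "\<rho> = mat d d (\<lambda>(i, j). f i j)"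
  have "quantum_state d \<rho>" unfolding \<rho>_def quantum_state_mat_iff using f by simp
  moreover have "(S_D \<rho>)\<^sup>2 = s_D\<^sup>2" "(S_X \<rho>)\<^sup>2 = s_X\<^sup>2" "(S_I \<rho>)\<^sup>2 = s_I\<^sup>2"
    unfolding \<rho>_def S_of_kernel[OF f \<open>d > 0\<close>] right_diff_distrib S by simp_all
  moreover have "0 \<le> S_D \<rho>" "0 \<le> S_X \<rho>" "0 \<le> S_I \<rho>"
    unfolding \<rho>_def by (rule S_of_kernel[OF f \<open>d > 0\<close>])+
  ultimately show ?L using assms by (intro exI[of _ \<rho>]) simp
qed

section \<open>Choice of the spectrum and the equivalence\<close>

text \<open>\<open>A\<close> and \<open>K\<close> stand for the squared norms of the real and the
  imaginary part. With \<open>m = d div 2\<close>, the thresholds \<open>1 / 2\<close> and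
  \<open>1 / (2 m)\<close> for \<open>A\<close> separate the ranges where the pure, the paired and
  the odd spectrum meet the upper bound on \<open>K\<close>.\<close>

lemma spectrum_exists:
  fixes A K :: real
  assumes "d \<ge> 2" "1 / real d \<le> A" "0 \<le> K" "K \<le> 1 - A" "K \<le> A"
    and odd: "odd d \<Longrightarrow> A < 1 / (real d - 1) \<Longrightarrow> K \<le> ((sqrt (real d - 1) + sqrt (real d * A - 1)) / real d)\<^sup>2"
  shows "\<exists>r. (\<forall>i. 0 \<le> r i) \<and> (\<Sum>i<d. r i) = 1 \<and> (\<Sum>i<d. (r i)\<^sup>2) = A \<and> K \<le> pair_sum d r"
proof -
  define m where "m = d div 2"
  have m: "m \<ge> 1" "d = 2 * m + d mod 2" using \<open>d \<ge> 2\<close> by (auto simp: m_def)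
  consider "1 / 2 \<le> A" | "1 / real (2 * m) \<le> A" "A < 1 / 2" | "A < 1 / real (2 * m)" by linarith
  then show ?thesis
  proof cases
    case 1
    moreover have "A \<le> 1" using assms by linarith
    ultimately obtain r where "\<forall>i. 0 \<le> r i" "(\<Sum>i<d. r i) = 1" "(\<Sum>i<d. (r i)\<^sup>2) = A" "pair_sum d r = 1 - A"
      using spectrum_pure[OF \<open>d \<ge> 2\<close>] by blast
    then show ?thesis using \<open>K \<le> 1 - A\<close> by (intro exI[of _ r]) simp
  next
    case 2
    have "d mod 2 \<le> 1" by simp
    from spectrum_paired[OF m this 2]
    obtain r where "\<forall>i. 0 \<le> r i" "(\<Sum>i<d. r i) = 1" "(\<Sum>i<d. (r i)\<^sup>2) = A" "pair_sum d r = A"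
      by blast
    then show ?thesis using \<open>K \<le> A\<close> by (intro exI[of _ r]) simp
  next
    case 3
    \<comment> \<open>For even \<open>d\<close> this range is empty, because
      \<open>2 * m = d\<close>.\<close>
    have "odd d"
    proof
      assume "even d"
      then have "2 * m = d" by (simp add: m_def)
      then show False using 3 assms(2) by simp
    qed
    then have d: "d = 2 * m + 1" by (simp add: m_def)
    then have "K \<le> ((sqrt (real d - 1) + sqrt (real d * A - 1)) / real d)\<^sup>2"
      using odd[OF \<open>odd d\<close>] 3 by simp
    then show ?thesis
      using spectrum_odd[OF m(1) d assms(2) 3] by metis
  qed
qed

theorem proposition3:
  fixes d :: nat and s_D s_X s_I :: real
  assumes "d \<ge> 2" and "s_D \<ge> 0" and "s_X \<ge> 0" and "s_I \<ge> 0"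
  shows "(\<exists>\<rho>. quantum_state d \<rho> \<and> (s_D, s_X, s_I) = (S_D \<rho>, S_X \<rho>, S_I \<rho>)) \<longleftrightarrow>
    s_D\<^sup>2 + s_X\<^sup>2 + s_I\<^sup>2 \<le> real d - 1 \<and>
    s_I\<^sup>2 \<le> 1 + s_D\<^sup>2 + s_X\<^sup>2 \<and>
    (odd d \<and> s_D\<^sup>2 + s_X\<^sup>2 \<le> 1 / (real d - 1) \<longrightarrow>
      sqrt (real d) * s_I \<le> sqrt (real d - 1) + sqrt (s_D\<^sup>2 + s_X\<^sup>2))"
    (is "_ \<longleftrightarrow> ?C")
proof -
  have d: "d > 0" "real d > 0" using \<open>d \<ge> 2\<close> by auto
  have t: "(sqrt (s_D\<^sup>2 + s_X\<^sup>2))\<^sup>2 = s_D\<^sup>2 + s_X\<^sup>2" by simp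
  show ?thesis
    unfolding state_exists_iff[OF d(1) assms(2-4)]
  proof
    assume "\<exists>f. psd_kernel d f \<and> (\<Sum>i<d. Re (f i i)) = 1 \<and>
      real d * (\<Sum>i<d. (Re (f i i))\<^sup>2) = 1 + s_D\<^sup>2 \<and>
      real d * (\<Sum>i<d. \<Sum>j<d. (Re (f i j))\<^sup>2) = 1 + s_D\<^sup>2 + s_X\<^sup>2 \<and>
      real d * (\<Sum>i<d. \<Sum>j<d. (Im (f i j))\<^sup>2) = s_I\<^sup>2"
    then obtain f where f: "psd_kernel d f" "(\<Sum>i<d. Re (f i i)) = 1"
      and Q: "real d * (\<Sum>i<d. \<Sum>j<d. (Re (f i j))\<^sup>2) = 1 + s_D\<^sup>2 + s_X\<^sup>2"
      and K: "real d * (\<Sum>i<d. \<Sum>j<d. (Im (f i j))\<^sup>2) = s_I\<^sup>2" by blast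
    \<comment> \<open>The purity is at most 1; this is the source of (i).\<close>
    have "(\<Sum>i<d. \<Sum>j<d. (Re (f i j))\<^sup>2) + (\<Sum>i<d. \<Sum>j<d. (Im (f i j))\<^sup>2) \<le> 1"
      using psd_kernel_sum_norm_le[OF f(1)] unfolding f(2) cmod_power2 sum.distrib by simp
    then have "real d * ((\<Sum>i<d. \<Sum>j<d. (Re (f i j))\<^sup>2) + (\<Sum>i<d. \<Sum>j<d. (Im (f i j))\<^sup>2)) \<le> real d"
      using mult_left_mono[of _ 1 "real d"] by simp
    then have 1: "s_D\<^sup>2 + s_X\<^sup>2 + s_I\<^sup>2 \<le> real d - 1"
      unfolding distrib_left Q K by simp
    have "real d * (\<Sum>i<d. \<Sum>j<d. (Im (f i j))\<^sup>2) \<le> real d * (\<Sum>i<d. \<Sum>j<d. (Re (f i j))\<^sup>2)"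
      using psd_kernel_Im_le_Re[OF f(1)] by (intro mult_left_mono) auto
    then have 2: "s_I\<^sup>2 \<le> 1 + s_D\<^sup>2 + s_X\<^sup>2" unfolding Q K .
    have 3: "sqrt (real d) * s_I \<le> sqrt (real d - 1) + sqrt (s_D\<^sup>2 + s_X\<^sup>2)"
      if "odd d" "s_D\<^sup>2 + s_X\<^sup>2 \<le> 1 / (real d - 1)"
    proof -
      have "(\<Sum>i<d. \<Sum>j<d. (Re (f i j))\<^sup>2) = (1 + (sqrt (s_D\<^sup>2 + s_X\<^sup>2))\<^sup>2) / real d"
        unfolding t using Q d by (simp add: field_simps)
      then have "real d * sqrt (\<Sum>i<d. \<Sum>j<d. (Im (f i j))\<^sup>2) \<le> sqrt (real d - 1) + sqrt (s_D\<^sup>2 + s_X\<^sup>2)"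
        using that \<open>d \<ge> 2\<close> by (intro psd_kernel_Im_odd[OF f]) (auto simp: t)
      moreover have "s_I = sqrt (real d) * sqrt (\<Sum>i<d. \<Sum>j<d. (Im (f i j))\<^sup>2)"
        unfolding real_sqrt_mult[symmetric] K using \<open>s_I \<ge> 0\<close> by simp
      ultimately show ?thesis by (simp flip: mult.assoc)
    qed
    show ?C using 1 2 3 by blast
  next
    assume C: ?C
    \<comment> \<open>The triple forces these values for the squared norms of the real and the
      imaginary part.\<close>
    define A where "A = (1 + s_D\<^sup>2 + s_X\<^sup>2) / real d"
    define K where "K = s_I\<^sup>2 / real d"
    have dA: "real d * A - 1 = s_D\<^sup>2 + s_X\<^sup>2" using d by (simp add: A_def)
    have "\<exists>r. (\<forall>i. 0 \<le> r i) \<and> (\<Sum>i<d. r i) = 1 \<and> (\<Sum>i<d. (r i)\<^sup>2) = A \<and> K \<le> pair_sum d r"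
    proof (rule spectrum_exists)
      show "1 / real d \<le> A" "0 \<le> K" "K \<le> A" "K \<le> 1 - A"
        using d C by (simp_all add: A_def K_def field_simps)
      assume "odd d" "A < 1 / (real d - 1)"
      \<comment> \<open>As \<open>d / (d - 1) - 1 = 1 / (d - 1)\<close>, the bound on
        \<open>A\<close> turns into the premise of (iii).\<close>
      have "real d * A \<le> real d * (1 / (real d - 1))"
        using \<open>A < 1 / (real d - 1)\<close> by (intro mult_left_mono) auto
      then have "s_D\<^sup>2 + s_X\<^sup>2 \<le> 1 / (real d - 1)"
        unfolding dA[symmetric] using \<open>d \<ge> 2\<close> by (simp add: field_simps)
      then have "sqrt (real d) * s_I \<le> sqrt (real d - 1) + sqrt (s_D\<^sup>2 + s_X\<^sup>2)"
        using C \<open>odd d\<close> by blast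
      then have "(sqrt (real d) * s_I)\<^sup>2 \<le> (sqrt (real d - 1) + sqrt (s_D\<^sup>2 + s_X\<^sup>2))\<^sup>2"
        using \<open>s_I \<ge> 0\<close> by (intro power_mono) auto
      then have "(sqrt (real d) * s_I)\<^sup>2 / (real d)\<^sup>2 \<le> (sqrt (real d - 1) + sqrt (s_D\<^sup>2 + s_X\<^sup>2))\<^sup>2 / (real d)\<^sup>2"
        by (intro divide_right_mono) auto
      moreover have "(sqrt (real d) * s_I)\<^sup>2 / (real d)\<^sup>2 = K"
      proof -
        have eq: "(sqrt (real d) * s_I)\<^sup>2 = real d * s_I\<^sup>2" by (simp add: power_mult_distrib)
        show ?thesis unfolding eq using d by (simp add: K_def power2_eq_square)
      qed
      ultimately show "K \<le> ((sqrt (real d - 1) + sqrt (real d * A - 1)) / real d)\<^sup>2"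
        unfolding dA power_divide by simp
    qed (use assms in auto)
    then obtain r where r: "\<forall>i. 0 \<le> r i" "(\<Sum>i<d. r i) = 1" "(\<Sum>i<d. (r i)\<^sup>2) = A" "K \<le> pair_sum d r" by blast
    have "0 \<le> K" using d by (simp add: K_def)
    then obtain f where f: "psd_kernel d f" "\<And>i j. Re (f i j) = (if i = j then r i else 0)"
      "(\<Sum>i<d. \<Sum>j<d. (Im (f i j))\<^sup>2) = K"
      using psd_kernel_of_spectrum[of r K d] r by blast
    have "(\<Sum>i<d. \<Sum>j<d. (Re (f i j))\<^sup>2) = (\<Sum>i<d. \<Sum>j<d. if j = i then (r i)\<^sup>2 else 0)"
      by (intro sum.cong refl) (simp add: f)
    then have Q: "(\<Sum>i<d. \<Sum>j<d. (Re (f i j))\<^sup>2) = A" using r(3) by simp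
    \<comment> \<open>The real part of \<open>f\<close> is diagonal, so its diagonal carries all of
      \<open>A\<close>. The value belonging to \<open>s_D\<close> lies between \<open>1 / d\<close>
      and \<open>A\<close>, within reach of rotations; what leaves the diagonal becomes the share of
      \<open>s_X\<close>.\<close>
    have "(\<Sum>i<d. Re (f i i)) = 1" "1 / real d \<le> (1 + s_D\<^sup>2) / real d" "(1 + s_D\<^sup>2) / real d \<le> (\<Sum>i<d. (Re (f i i))\<^sup>2)"
      using d r by (simp_all add: f A_def divide_right_mono)
    from psd_kernel_prescribe_diag[OF f(1) this]
    obtain g where g: "psd_kernel d g" "(\<Sum>i<d. Re (g i i)) = 1" "(\<Sum>i<d. (Re (g i i))\<^sup>2) = (1 + s_D\<^sup>2) / real d"
      "(\<Sum>i<d. \<Sum>j<d. (Re (g i j))\<^sup>2) = A" "(\<Sum>i<d. \<Sum>j<d. (Im (g i j))\<^sup>2) = K"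
      unfolding Q f(3) by blast
    show "\<exists>f. psd_kernel d f \<and> (\<Sum>i<d. Re (f i i)) = 1 \<and>
      real d * (\<Sum>i<d. (Re (f i i))\<^sup>2) = 1 + s_D\<^sup>2 \<and>
      real d * (\<Sum>i<d. \<Sum>j<d. (Re (f i j))\<^sup>2) = 1 + s_D\<^sup>2 + s_X\<^sup>2 \<and>
      real d * (\<Sum>i<d. \<Sum>j<d. (Im (f i j))\<^sup>2) = s_I\<^sup>2"
      using g d by (intro exI[of _ g]) (simp add: A_def K_def)
  qed
qed

end
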